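(* Let $G$ be a finite-by-abelian group of cardinality $\omega_1$. Then $G\in\mathcal{Y}$ if and only if $G\in\mathcal{Z}$.
   Context: A group $G$ is finite-by-abelian if its derived subgroup $G'$ is finite. $\mathcal{Z}$ is the class of locally finite groups $G$ such that for every cardinal $\kappa$ and every subgroup $H\le G$ with $|H|<\kappa$ one has $[G:C_G(H)]<\kappa$. $\mathcal{Y}$ is the class of locally finite groups $G$ such that for every cardinal $\kappa$ and every subgroup $H\le G$ with $|H|<\kappa$ one has $[G:N_G(H)]<\kappa$. Here $C_G(H)$ and $N_G(H)$ are the centralizer and normalizer of $H$ in $G$.
   Formalization: In the definitions of Z and Y, "every cardinal κ" is read as "every infinite cardinal κ"; with finite κ admitted the equivalence fails for some finite-by-abelian groups of cardinality ω_1. *)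

theory Defs
  imports "HOL-Algebra.Algebra"
begin

unbundle cardinal_syntax

definition finite_by_abelian :: "('a, 'b) monoid_scheme \<Rightarrow> bool" where
  "finite_by_abelian G \<longleftrightarrow> group G \<and> finite (derived G (carrier G))"

definition locally_finite_group :: "('a, 'b) monoid_scheme \<Rightarrow> bool" where
  "locally_finite_group G \<longleftrightarrow>
     group G \<and> (\<forall>S. S \<subseteq> carrier G \<longrightarrow> finite S \<longrightarrow> finite (generate G S))"

definition centralizer :: "('a, 'b) monoid_scheme \<Rightarrow> 'a set \<Rightarrow> 'a set" where
  "centralizer G H = {g \<in> carrier G. \<forall>h\<in>H. g \<otimes>\<^bsub>G\<^esub> h = h \<otimes>\<^bsub>G\<^esub> g}"

text \<open>
  In the two classes below, cardinals are infinite cardinals, as is usual for these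
  conditions: admitting finite ones would demand \<open>[G : C\<^sub>G(H)] \<le> |H|\<close>, respectively
  \<open>[G : N\<^sub>G(H)] \<le> |H|\<close>, for every finite subgroup \<open>H\<close>, which fails already for
  the symmetric group on three letters.

  A bound variable ranges over a single type, so the cardinals are taken on \<^typ>\<open>'a set\<close>,
  the power type of the type of the group elements. This covers all relevant cardinals,
  because nothing is demanded by cardinals above \<open>|carrier G|\<close>; the lemmas
  \<open>class_Z_all_cardinals\<close> and \<open>class_Y_all_cardinals\<close> give the conditions for infinite
  cardinals on an arbitrary type.
\<close>

definition class_Z :: "('a, 'b) monoid_scheme \<Rightarrow> bool" where
  "class_Z G \<longleftrightarrow> locally_finite_group G \<and>
     (\<forall>\<kappa> :: 'a set rel. Cinfinite \<kappa> \<longrightarrow>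
       (\<forall>H. subgroup H G \<longrightarrow> |H| <o \<kappa> \<longrightarrow> |rcosets\<^bsub>G\<^esub> (centralizer G H)| <o \<kappa>))"

definition class_Y :: "('a, 'b) monoid_scheme \<Rightarrow> bool" where
  "class_Y G \<longleftrightarrow> locally_finite_group G \<and>
     (\<forall>\<kappa> :: 'a set rel. Cinfinite \<kappa> \<longrightarrow>
       (\<forall>H. subgroup H G \<longrightarrow> |H| <o \<kappa> \<longrightarrow> |rcosets\<^bsub>G\<^esub> (normalizer G H)| <o \<kappa>))"

lemma index_less_all_cardinals:
  fixes G :: "('a, 'b) monoid_scheme" and \<kappa> :: "'c rel"
  assumes *: "\<And>\<mu> :: 'a set rel. Cinfinite \<mu> \<Longrightarrow> |H| <o \<mu> \<Longrightarrow> |rcosets\<^bsub>G\<^esub> K| <o \<mu>"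
    and \<kappa>: "Cinfinite \<kappa>" and H: "|H| <o \<kappa>"
  shows "|rcosets\<^bsub>G\<^esub> K| <o \<kappa>"
proof (cases "|carrier G| <o \<kappa>")
  case True
  have "rcosets\<^bsub>G\<^esub> K = (\<lambda>a. K #>\<^bsub>G\<^esub> a) ` carrier G"
    unfolding RCOSETS_def by auto
  then have "|rcosets\<^bsub>G\<^esub> K| \<le>o |carrier G|"
    by (simp add: card_of_image)
  then show ?thesis
    using True by (rule ordLeq_ordLess_trans)
next
  case False
  have field: "|Field \<kappa>| =o \<kappa>"
    using \<kappa> by (simp add: card_of_Field_ordIso)
  have "\<kappa> \<le>o |carrier G|"
    using False \<kappa> by (simp add: not_ordLess_iff_ordLeq card_order_on_well_order_on)
  then have "|Field \<kappa>| \<le>o |carrier G|"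
    using field by (rule ordIso_ordLeq_trans[rotated])
  then obtain f where f: "inj_on f (Field \<kappa>)" "f ` Field \<kappa> \<subseteq> carrier G"
    by (meson card_of_ordLeq)
  define A where "A = (\<lambda>x. {f x}) ` Field \<kappa>"
  have "bij_betw (\<lambda>x. {f x}) (Field \<kappa>) A"
    using f(1) unfolding A_def bij_betw_def inj_on_def by auto
  then have "|Field \<kappa>| =o |A|"
    using card_of_ordIso by blast
  then have iso: "\<kappa> =o |A|"
    using field ordIso_symmetric ordIso_transitive by blast
  have "Cinfinite |A|"
    using Cinfinite_cong[OF iso \<kappa>] .
  moreover have "|H| <o |A|"
    using H iso by (rule ordLess_ordIso_trans)
  ultimately have "|rcosets\<^bsub>G\<^esub> K| <o |A|"
    by (rule *)
  then show ?thesis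
    using ordIso_symmetric[OF iso] by (rule ordLess_ordIso_trans)
qed

lemma class_Z_all_cardinals:
  assumes "class_Z G" "Cinfinite \<kappa>" "subgroup H G" "|H| <o \<kappa>"
  shows "|rcosets\<^bsub>G\<^esub> (centralizer G H)| <o \<kappa>"
  using assms unfolding class_Z_def by (blast intro: index_less_all_cardinals)

lemma class_Y_all_cardinals:
  assumes "class_Y G" "Cinfinite \<kappa>" "subgroup H G" "|H| <o \<kappa>"
  shows "|rcosets\<^bsub>G\<^esub> (normalizer G H)| <o \<kappa>"
  using assms unfolding class_Y_def by (blast intro: index_less_all_cardinals)

end

theory Submission
  imports Defs "HOL-Library.Countable_Set_Type"
begin

text \<open>
  If \<open>K\<close> is a countable subgroup with \<open>K \<inter> G' = 1\<close>, then \<open>[K, N\<^sub>G(K)] \<le> K \<inter> G' = 1\<close>, so the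
  normalizer of \<open>K\<close> is its centralizer. Only countable \<open>H\<close> matter. Passing to \<open>C = C\<^sub>G(G')\<close>,
  commutators form an alternating bimultiplicative map from \<open>C \<times> C\<close> to the finite central group
  \<open>T = G' \<inter> C\<close>. It suffices to treat it modulo each \<open>S \<le> T\<close> maximal among the subgroups avoiding a
  given \<open>t \<noteq> 1\<close>, since finitely many such \<open>S\<close> intersect trivially; then \<open>T / S\<close> is uniserial.
  If \<open>A\<close> is isotropic modulo \<open>S\<close>, the remark above, applied modulo \<open>S\<close> to \<open>K \<le> A\<close> maximal
  with \<open>K \<inter> T = S\<close>, shows that the complement of \<open>A\<close> has countable index. Finally, every
  countable \<open>H \<le> C\<close> is generated by a finite set and four subgroups isotropic modulo \<open>S\<close>.
\<close>

section \<open>Abelian groups with finite socle: torsion and cosets of powers\<close>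

text \<open>An element of prime order is a power of every nontrivial element it generates, so it
  lies in \<open>T\<close>. For composite \<open>n = p * k\<close> the \<open>p\<close>-th power map
  sends the \<open>n\<close>-torsion into the \<open>k\<close>-torsion, and each of its fibres is
  empty or a translate of the \<open>p\<close>-torsion.\<close>

lemma (in comm_group) finite_torsion_if_finite_socle:
  assumes T: "finite T" "subgroup T G"
    and soc: "\<And>x. x \<in> carrier G \<Longrightarrow> x \<noteq> \<one> \<Longrightarrow> \<exists>y\<in>generate G {x}. y \<in> T \<and> y \<noteq> \<one>"
  shows "n > 0 \<Longrightarrow> finite {x \<in> carrier G. x [^] (n::nat) = \<one>}"
proof (induction n rule: less_induct)
  case (less n)
  have prime_case: "finite {x \<in> carrier G. x [^] p = \<one>}" if "Factorial_Ring.prime p" for p :: nat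
  proof (rule finite_subset[OF _ T(1)], safe)
    fix x assume x: "x \<in> carrier G" "x [^] p = \<one>"
    show "x \<in> T"
    proof (cases "x = \<one>")
      case True then show ?thesis using T(2) by (simp add: subgroup.one_closed)
    next
      case False
      then obtain y where y: "y \<in> generate G {x}" "y \<in> T" "y \<noteq> \<one>" using soc x by blast
      then obtain j :: int where j: "y = x [^] j" using generate_pow[OF x(1)] by auto
      have xp: "x [^] int p = \<one>" using x by (simp add: int_pow_int)
      have "\<not> int p dvd j"
      proof
        assume "int p dvd j"
        then obtain i where "j = int p * i" by blast
        then have "y = (x [^] int p) [^] i" using j x(1) by (simp add: int_pow_pow)
        then show False using xp y(3) by simp
      qed
      \<comment> \<open>A Bezout relation between \<open>p\<close> and \<open>j\<close> recovers
        \<open>x\<close> as a power of \<open>y\<close>.\<close>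
      then have "coprime (int p) j" using that by (simp add: prime_imp_coprime)
      then obtain a b where ab: "a * int p + b * j = 1"
        by (metis bezout_int coprime_imp_gcd_eq_1)
      have "x = x [^] (int p * a + j * b)" using ab x(1) by (simp add: mult.commute)
      also have "\<dots> = (x [^] int p) [^] a \<otimes> y [^] b"
        using x(1) j by (simp add: int_pow_mult int_pow_pow)
      also have "\<dots> = y [^] b" using x(1) xp j by simp
      finally show ?thesis using subgroup_int_pow_closed[OF T(2) y(2)] by metis
    qed
  qed
  show ?case
  proof (cases "n = 1")
    case True
    then have "{x \<in> carrier G. x [^] n = \<one>} \<subseteq> {\<one>}" by auto
    then show ?thesis using finite_subset by blast
  next
    case False
    then obtain p where p: "Factorial_Ring.prime p" "p dvd n" using prime_factor_nat by blast
    then obtain k where k: "n = p * k" by blast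
    then have "k < n" "k > 0" using less.prems p(1) prime_gt_1_nat by auto
    then have fk: "finite {x \<in> carrier G. x [^] k = \<one>}" (is "finite ?K") by (rule less.IH)
    have "finite {x \<in> carrier G. x [^] p = y}" for y
    proof (cases "\<exists>z\<in>carrier G. z [^] p = y")
      case True
      then obtain z where z: "z \<in> carrier G" "z [^] p = y" by blast
      have yc: "y \<in> carrier G" using z by blast
      have "x \<in> (\<lambda>w. w \<otimes> z) ` {x \<in> carrier G. x [^] p = \<one>}" if "x \<in> carrier G" "x [^] p = y" for x
      proof
        show "x = x \<otimes> inv z \<otimes> z" using that z by (simp add: m_assoc)
        show "x \<otimes> inv z \<in> {x \<in> carrier G. x [^] p = \<one>}"
          using that z yc by (simp add: nat_pow_distrib nat_pow_inv)
      qed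
      then have "{x \<in> carrier G. x [^] p = y} \<subseteq> (\<lambda>w. w \<otimes> z) ` {x \<in> carrier G. x [^] p = \<one>}" by blast
      then show ?thesis using prime_case[OF p(1)] finite_surj by blast
    next
      case False
      then have e: "{x \<in> carrier G. x [^] p = y} = {}" by blast
      show ?thesis unfolding e by simp
    qed
    then have "finite (\<Union>y\<in>?K. {x \<in> carrier G. x [^] p = y})" using fk by blast
    moreover have "{x \<in> carrier G. x [^] n = \<one>} \<subseteq> (\<Union>y\<in>?K. {x \<in> carrier G. x [^] p = y})"
      using k by (auto simp: nat_pow_pow)
    ultimately show ?thesis using finite_subset by blast
  qed
qed

text \<open>In a finite subgroup \<open>B\<close> there are at most as many cosets of the
  \<open>m\<close>-th powers as elements killed by \<open>m\<close>. This bounds every set of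
  elements that are pairwise incongruent modulo \<open>m\<close>-th powers, and a largest such set
  is the required \<open>F\<close>.\<close>

lemma (in comm_group) finite_mod_powers:
  fixes m :: nat
  assumes lf: "\<And>R. R \<subseteq> carrier G \<Longrightarrow> finite R \<Longrightarrow> finite (generate G R)"
    and tors: "finite {x \<in> carrier G. x [^] m = \<one>}"
  obtains F where "finite F" "F \<subseteq> carrier G"
    "\<And>x. x \<in> carrier G \<Longrightarrow> \<exists>f\<in>F. \<exists>y\<in>carrier G. x = y [^] m \<otimes> f"
proof -
  define M where "M = {x \<in> carrier G. x [^] m = \<one>}"
  define indep where "indep R \<longleftrightarrow> R \<subseteq> carrier G \<and> finite R \<and>
    (\<forall>f\<in>R. \<forall>g\<in>R. (\<exists>y\<in>carrier G. f = y [^] m \<otimes> g) \<longrightarrow> f = g)" for R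
  have bound: "card R \<le> card M" if "indep R" for R
  proof -
    have R: "R \<subseteq> carrier G" "finite R" using that by (auto simp: indep_def)
    define B where "B = generate G R"
    define P where "P = (\<lambda>y. y [^] m) ` B"
    have B: "finite B" "subgroup B G" "R \<subseteq> B"
      unfolding B_def using lf R by (auto simp: generate_is_subgroup generate.incl)
    have Bc: "B \<subseteq> carrier G" using B(2) by (rule subgroup.subset)
    have Pfin: "finite P" "P \<noteq> {}" unfolding P_def using B by (auto simp: subgroup_def)
    have PB: "P \<subseteq> B" unfolding P_def
      using subgroup_int_pow_closed[OF B(2), of _ "int m"] by (auto simp: int_pow_int)
    \<comment> \<open>The translates of \<open>P\<close> by elements of \<open>R\<close> are
      disjoint in \<open>B\<close>; together with the bound on the fibres of the power map below,
      this compares \<open>card R\<close> with \<open>card M\<close>.\<close>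
    have "inj_on (\<lambda>(f, p). p \<otimes> f) (R \<times> P)"
    proof (rule inj_onI, clarify)
      fix f p g q assume *: "f \<in> R" "p \<in> P" "g \<in> R" "q \<in> P" "p \<otimes> f = q \<otimes> g"
      then obtain y z where yz: "y \<in> B" "z \<in> B" "p = y [^] m" "q = z [^] m" unfolding P_def by auto
      then have c: "y \<in> carrier G" "z \<in> carrier G" "f \<in> carrier G" "g \<in> carrier G"
        using Bc R * by auto
      have "f = inv p \<otimes> (p \<otimes> f)" using c yz by (simp add: m_assoc[symmetric])
      also have "\<dots> = (inv y \<otimes> z) [^] m \<otimes> g"
        unfolding *(5) using c yz by (simp add: nat_pow_distrib nat_pow_inv m_assoc)
      finally have "\<exists>y\<in>carrier G. f = y [^] m \<otimes> g" using c by blast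
      then have "f = g" using \<open>indep R\<close> *(1,3) unfolding indep_def by simp
      then show "f = g \<and> p = q" using * c yz by auto
    qed
    moreover have "(\<lambda>(f, p). p \<otimes> f) ` (R \<times> P) \<subseteq> B"
      using PB B by (auto intro: subgroup.m_closed)
    ultimately have 1: "card R * card P \<le> card B"
      using card_inj_on_le[of _ "R \<times> P" B] B(1) by (simp add: card_cartesian_product)
    have "card {x \<in> B. x [^] m = p} \<le> card M" if p: "p \<in> P" for p
    proof -
      obtain z where z: "z \<in> B" "p = z [^] m" using p P_def by auto
      then have zc: "z \<in> carrier G" using Bc by auto
      have "inj_on (\<lambda>x. x \<otimes> inv z) {x \<in> B. x [^] m = p}"
        using Bc zc by (auto simp: inj_on_def subset_iff)
      moreover have "(\<lambda>x. x \<otimes> inv z) ` {x \<in> B. x [^] m = p} \<subseteq> M"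
        unfolding M_def using Bc zc z by (auto simp: nat_pow_distrib nat_pow_inv)
      ultimately show ?thesis using card_inj_on_le tors M_def by blast
    qed
    moreover have "B = (\<Union>p\<in>P. {x \<in> B. x [^] m = p})" unfolding P_def by auto
    then have "card B \<le> (\<Sum>p\<in>P. card {x \<in> B. x [^] m = p})"
      using card_UN_le[OF Pfin(1)] by metis
    ultimately have "card B \<le> card P * card M"
      using sum_bounded_above[of P "\<lambda>p. card {x \<in> B. x [^] m = p}" "card M"] by simp
    then have "card P * card R \<le> card P * card M" using 1 by (metis le_trans mult.commute)
    moreover have "card P > 0" using Pfin by (simp add: card_gt_0_iff)
    ultimately show ?thesis by (metis mult_le_cancel1)
  qed
  have "indep {}" by (simp add: indep_def)
  then obtain R where R: "indep R" "\<And>R'. indep R' \<Longrightarrow> card R' \<le> card R"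
    using ex_has_greatest_nat[of indep "{}" card "Suc (card M)"] bound le_imp_less_Suc by metis
  have "\<exists>f\<in>R. \<exists>y\<in>carrier G. x = y [^] m \<otimes> f" if x: "x \<in> carrier G" for x
  proof (rule ccontr)
    assume neg: "\<not> ?thesis"
    have Rc: "R \<subseteq> carrier G" "finite R" using R by (auto simp: indep_def)
    have "x = \<one> [^] m \<otimes> x" using x by simp
    then have "x \<notin> R" using neg by blast
    have "False" if "f \<in> R" "y \<in> carrier G" "f = y [^] m \<otimes> x" for f y
    proof -
      have "x = (inv y) [^] m \<otimes> f" using that x by (simp add: nat_pow_inv m_assoc[symmetric])
      then show False using neg that by blast
    qed
    then have "indep (insert x R)" using R(1) x neg Rc unfolding indep_def by (metis finite_insert insert_iff insert_subset)
    then show False using R(2) \<open>x \<notin> R\<close> Rc(2) by fastforce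
  qed
  then show thesis using that R(1) unfolding indep_def by blast
qed

section \<open>Cyclic extensions of a subgroup and uniserial quotients\<close>

text \<open>In an abelian group with a subgroup \<open>S\<close> this is the subgroup generated by
  \<open>S\<close> and \<open>v\<close>. The exponent is kept explicit because later arguments read
  it off and compute with it.\<close>

definition pow_coset :: "('a, 'b) monoid_scheme \<Rightarrow> 'a set \<Rightarrow> 'a \<Rightarrow> 'a set" where
  "pow_coset G S v = {v [^]\<^bsub>G\<^esub> (j::int) \<otimes>\<^bsub>G\<^esub> s | j s. s \<in> S}"

lemma (in comm_group) pow_coset_subgroup:
  assumes "subgroup S G" "v \<in> carrier G"
  shows "subgroup (pow_coset G S v) G" "S \<subseteq> pow_coset G S v" "v \<in> pow_coset G S v"
proof -
  have Sc: "S \<subseteq> carrier G" using assms by (simp add: subgroup.subset)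
  show S: "S \<subseteq> pow_coset G S v"
  proof
    fix s assume "s \<in> S"
    then show "s \<in> pow_coset G S v"
      using Sc unfolding pow_coset_def by (auto intro!: exI[of _ "0::int"] exI[of _ s])
  qed
  have "v = v [^] (1::int) \<otimes> \<one>" using assms by simp
  then show "v \<in> pow_coset G S v"
    using subgroup.one_closed[OF assms(1)] unfolding pow_coset_def by blast
  show "subgroup (pow_coset G S v) G"
  proof
    show "pow_coset G S v \<subseteq> carrier G" using Sc assms by (auto simp: pow_coset_def)
    show "\<one> \<in> pow_coset G S v" using S assms(1) by (auto simp: subgroup.one_closed)
    show "x \<otimes> y \<in> pow_coset G S v" if xy: "x \<in> pow_coset G S v" "y \<in> pow_coset G S v" for x y
    proof -
      obtain i s j r where *: "x = v [^] (i::int) \<otimes> s" "s \<in> S" "y = v [^] (j::int) \<otimes> r" "r \<in> S"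
        using xy unfolding pow_coset_def by blast
      then have "x \<otimes> y = v [^] (i + j) \<otimes> (s \<otimes> r)"
        using assms(2) Sc by (auto simp: int_pow_mult m_ac subset_iff)
      then show ?thesis using subgroup.m_closed[OF assms(1) *(2,4)] unfolding pow_coset_def by blast
    qed
    show "inv x \<in> pow_coset G S v" if x: "x \<in> pow_coset G S v" for x
    proof -
      obtain i s where *: "x = v [^] (i::int) \<otimes> s" "s \<in> S" using x unfolding pow_coset_def by blast
      then have "inv x = v [^] (- i) \<otimes> inv s"
        using assms(2) Sc by (auto simp: int_pow_neg inv_mult subset_iff)
      then show ?thesis using subgroup.m_inv_closed[OF assms(1) *(2)] unfolding pow_coset_def by blast
    qed
  qed
qed

lemma (in comm_group) pow_coset_least:
  assumes "subgroup R G" "S \<subseteq> R" "v \<in> R"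
  shows "pow_coset G S v \<subseteq> R"
  using assms by (auto simp: pow_coset_def subgroup_int_pow_closed subgroup.m_closed subset_iff)

text \<open>A finite abelian group with a least nontrivial subgroup is uniserial; here the group is
  \<open>G / S\<close>.\<close>

lemma (in comm_group) uniserial_mod:
  assumes fin: "finite (carrier G)" and S: "subgroup S G"
    and t: "t \<in> carrier G" "t \<notin> S"
    and mono: "\<And>R. subgroup R G \<Longrightarrow> S \<subset> R \<Longrightarrow> t \<in> R"
    and u: "u \<in> carrier G" and v: "v \<in> carrier G"
  shows "u \<in> pow_coset G S v \<or> v \<in> pow_coset G S u"
proof -
  have Sc: "S \<subseteq> carrier G" using S by (simp add: subgroup.subset)
  have t_in: "t \<in> pow_coset G S w" if "w \<in> carrier G" "w \<notin> S" for w
    using mono[of "pow_coset G S w"] pow_coset_subgroup[OF S that(1)] that by blast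
  have Snat: "s [^] (n::nat) \<in> S" if "s \<in> S" for s n
    using subgroup_int_pow_closed[OF S that] by (metis int_pow_int)
  have Sint: "s [^] (n::int) \<in> S" if "s \<in> S" for s n
    using subgroup_int_pow_closed[OF S that] .
  have bez: "x \<in> S" if h: "x \<in> carrier G" "x [^] a \<in> S" "x [^] b \<in> S" "coprime a b" for x and a b :: nat
  proof -
    obtain i j where ij: "i * int a + j * int b = 1"
      using h(4) by (metis bezout_int coprime_imp_gcd_eq_1 coprime_int_iff)
    have "x = x [^] (int a * i + int b * j)" using ij that(1) by (simp add: mult.commute)
    also have "\<dots> = (x [^] a) [^] i \<otimes> (x [^] b) [^] j"
      using that(1) by (simp add: int_pow_mult int_pow_pow int_pow_int[symmetric])
    finally show ?thesis using that Sint S by (metis subgroup.m_closed)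
  qed
  have ex_n: "\<exists>n::nat. n > 0 \<and> t [^] n \<in> S"
    using pow_order_eq_1[OF t(1)] order_gt_0_iff_finite fin S by (metis subgroup.one_closed)
  define n where "n = (LEAST n::nat. n > 0 \<and> t [^] n \<in> S)"
  have n: "n > 0" "t [^] n \<in> S" using LeastI_ex[OF ex_n] by (auto simp: n_def)
  have nl: "t [^] k \<notin> S" if "0 < k" "k < n" for k
    using not_less_Least[of k "\<lambda>n. n > 0 \<and> t [^] n \<in> S"] that by (auto simp: n_def)
  have "n \<noteq> 1" using n t by auto
  \<comment> \<open>The order of \<open>t\<close> modulo \<open>S\<close> turns out to be the prime
    \<open>p\<close>: as \<open>t [^] k\<close> is outside \<open>S\<close>, \<open>t\<close> is a
    power of it modulo \<open>S\<close>, and the \<open>p\<close>-th power of \<open>t [^] k\<close>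
    is \<open>t [^] n\<close>.\<close>
  then obtain p where p: "Factorial_Ring.prime p" "p dvd n" using prime_factor_nat by blast
  then obtain k where k: "n = k * p" by (metis dvd_def mult.commute)
  have "k > 0" "k < n" using k n(1) prime_gt_1_nat[OF p(1)] by auto
  then have tk: "t [^] k \<notin> S" using nl by blast
  then obtain j s where js: "t = (t [^] k) [^] (j::int) \<otimes> s" "s \<in> S"
    using t_in[of "t [^] k"] t(1) by (auto simp: pow_coset_def)
  have pw: "(a [^] (j::int) \<otimes> s) [^] (q::nat) = (a [^] q) [^] j \<otimes> s [^] q"
    if "a \<in> carrier G" "s \<in> carrier G" for a s j q
  proof -
    have "(a [^] j) [^] int q = (a [^] int q) [^] j"
      using that by (simp add: int_pow_pow mult.commute)
    then show ?thesis using that by (simp add: nat_pow_distrib int_pow_int)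
  qed
  have tp: "t [^] p \<in> S"
  proof -
    have "t [^] p = ((t [^] k) [^] p) [^] j \<otimes> s [^] p"
      using js pw[of "t [^] k" s j p] t(1) Sc by auto
    moreover have "(t [^] k) [^] p \<in> S" using n(2) k t(1) by (simp add: nat_pow_pow)
    ultimately show ?thesis using Snat Sint js(2) S by (simp add: subgroup.m_closed)
  qed
  \<comment> \<open>Modulo \<open>S\<close>, \<open>t\<close> is a power of \<open>w\<close> with
    exponent prime to \<open>p\<close>, so \<open>w\<close> is a power of \<open>t\<close>; and
    \<open>t\<close> lies in every cyclic extension of \<open>S\<close> by an element outside
    \<open>S\<close>.\<close>
  have order_p: "w \<in> pow_coset G S x"
    if w: "w \<in> carrier G" "w [^] p \<in> S" "w \<notin> S" and x: "x \<in> carrier G" "x \<notin> S" for w x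
  proof -
    obtain c r where cr: "t = w [^] (c::int) \<otimes> r" "r \<in> S"
      using t_in[OF w(1,3)] by (auto simp: pow_coset_def)
    have rc: "r \<in> carrier G" using cr Sc by blast
    have wp: "w [^] int p \<in> S" using w by (simp add: int_pow_int)
    have "\<not> int p dvd c"
    proof
      assume "int p dvd c"
      then obtain d where "c = int p * d" by blast
      then have "w [^] c = (w [^] int p) [^] d" using w(1) by (simp add: int_pow_pow)
      then have "w [^] c \<in> S" using Sint wp by simp
      then show False using cr t S by (simp add: subgroup.m_closed)
    qed
    then have "coprime (int p) c" using p by (simp add: prime_imp_coprime)
    then obtain a b where ab: "a * int p + b * c = 1"
      by (metis bezout_int coprime_imp_gcd_eq_1)
    have "w = w [^] (int p * a + c * b)" using ab w(1) by (simp add: mult.commute)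
    also have "\<dots> = (w [^] int p) [^] a \<otimes> (w [^] c) [^] b"
      using w(1) by (simp add: int_pow_mult int_pow_pow)
    also have "w [^] c = t \<otimes> inv r" using cr rc w(1) by (simp add: m_assoc)
    finally have "w = (w [^] int p) [^] a \<otimes> (t \<otimes> inv r) [^] b" .
    moreover have "subgroup (pow_coset G S x) G" "S \<subseteq> pow_coset G S x" "t \<in> pow_coset G S x"
      using pow_coset_subgroup[OF S x(1)] t_in x by auto
    ultimately show ?thesis using wp cr(2)
      by (metis subgroup_int_pow_closed subgroup.m_closed subgroup.m_inv_closed subset_iff)
  qed
  \<comment> \<open>Comparing \<open>p\<close>-th powers first, \<open>a\<close> can be divided by a
    power of \<open>b\<close> so that the quotient \<open>w\<close> has its \<open>p\<close>-th
    power in \<open>S\<close>; then \<open>order_p\<close> applies to \<open>w\<close>.\<close>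
  have step: "a \<in> pow_coset G S b"
    if "a \<in> carrier G" "b \<in> carrier G" "a [^] (p ^ Suc k) \<in> S" "b [^] (p ^ k) \<notin> S" for a b k
    using that
  proof (induction k arbitrary: a b)
    case 0
    then have "b \<notin> S" by simp
    then show ?case using 0 order_p[of a b] pow_coset_subgroup(2)[OF S, of b] by auto
  next
    case (Suc k)
    have "a [^] p \<in> pow_coset G S (b [^] p)"
      using Suc.prems by (intro Suc.IH) (auto simp: nat_pow_pow)
    then obtain i s where i: "a [^] p = (b [^] p) [^] (i::int) \<otimes> s" "s \<in> S"
      by (auto simp: pow_coset_def)
    define w where "w = a \<otimes> inv (b [^] i)"
    have wc: "w \<in> carrier G" using Suc.prems by (simp add: w_def)
    have b: "b \<notin> S" using Suc.prems Snat by blast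
    note sub = pow_coset_subgroup[OF S Suc.prems(2)]
    have "(b [^] i) [^] p = (b [^] p) [^] i" using pw[of b \<one> i p] Suc.prems by simp
    then have "w [^] p = a [^] p \<otimes> inv ((b [^] p) [^] i)"
      using Suc.prems by (simp add: w_def nat_pow_distrib nat_pow_inv)
    also have "\<dots> = s" unfolding i(1) using Suc.prems i(2) Sc
      by (simp add: m_comm[of _ s] m_assoc subset_iff)
    finally have "w [^] p \<in> S" using i(2) by simp
    then have "w \<in> pow_coset G S b" using order_p[of w b] wc b Suc.prems sub by blast
    moreover have "b [^] i \<in> pow_coset G S b" using sub by (simp add: subgroup_int_pow_closed)
    moreover have "a = w \<otimes> b [^] i" using Suc.prems by (simp add: w_def m_assoc)
    ultimately show ?case using sub by (simp add: subgroup.m_closed)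
  qed
  \<comment> \<open>The quotient by \<open>S\<close> is a \<open>p\<close>-group: otherwise some
    \<open>z\<close> outside \<open>S\<close> has order dividing an \<open>m\<close> prime to
    \<open>p\<close>, and \<open>t\<close>, a power of \<open>z\<close> modulo \<open>S\<close>,
    would have both \<open>t [^] m\<close> and \<open>t [^] p\<close> in \<open>S\<close>.\<close>
  have p_power: "\<exists>k. w [^] (p ^ k) \<in> S" if w: "w \<in> carrier G" for w
  proof -
    have "order G \<noteq> 0" using fin order_gt_0_iff_finite by simp
    then obtain k m where km: "order G = p ^ k * m" "\<not> p dvd m"
      using p(1) by (metis not_prime_unit prime_nat_iff multiplicity_decompose' mult.commute)
    have "coprime p m" using km(2) p(1) by (simp add: prime_imp_coprime)
    define z where "z = w [^] (p ^ k)"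
    have zc: "z \<in> carrier G" using w by (simp add: z_def)
    have zm: "z [^] m = \<one>" using pow_order_eq_1[OF w] w km(1) by (simp add: z_def nat_pow_pow)
    have "z \<in> S"
    proof (rule ccontr)
      assume "z \<notin> S"
      then obtain j s where js: "t = z [^] (j::int) \<otimes> s" "s \<in> S"
        using t_in[OF zc] unfolding pow_coset_def by blast
      then have "t [^] m = s [^] m" using pw[of z s j m] zc zm Sc by auto
      then have "t [^] m \<in> S" using Snat js by simp
      then show False using bez[OF t(1) tp] \<open>coprime p m\<close> t by blast
    qed
    then show ?thesis by (auto simp: z_def)
  qed
  \<comment> \<open>The order of \<open>w\<close> modulo \<open>S\<close> is \<open>p ^ K w\<close>;
    of two elements, the one with the smaller exponent lies in the cyclic extension by the
    other.\<close>
  define K where "K w = (LEAST k. w [^] (p ^ k) \<in> S)" for w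
  have K1: "w [^] (p ^ K w) \<in> S" if "w \<in> carrier G" for w
    using LeastI_ex[OF p_power[OF that]] by (simp add: K_def)
  have K2: "w [^] (p ^ k) \<notin> S" if "k < K w" for w k
    using not_less_Least that unfolding K_def by blast
  have "a \<in> pow_coset G S b" if "a \<in> carrier G" "b \<in> carrier G" "K a \<le> K b" for a b
  proof (cases "K a")
    case 0
    then have "a \<in> S" using K1[OF that(1)] that(1) by simp
    then show ?thesis using pow_coset_subgroup(2)[OF S that(2)] by blast
  next
    case (Suc k)
    then show ?thesis using step[of a b k] K1[OF that(1)] K2[of k b] that by simp
  qed
  then show ?thesis using u v by (meson nat_le_linear)
qed

section \<open>Countable index, centralizers and commutators\<close>

definition commutator :: "('a, 'b) monoid_scheme \<Rightarrow> 'a \<Rightarrow> 'a \<Rightarrow> 'a" where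
  "commutator G x y = x \<otimes>\<^bsub>G\<^esub> y \<otimes>\<^bsub>G\<^esub> inv\<^bsub>G\<^esub> x \<otimes>\<^bsub>G\<^esub> inv\<^bsub>G\<^esub> y"

text \<open>A map into the naturals that separates the right cosets. It makes sense for any set
  \<open>L\<close>, so enlarging and intersecting need no coset calculations;
  \<open>countable_index_iff\<close> translates it for subgroups.\<close>

definition countable_index :: "('a, 'b) monoid_scheme \<Rightarrow> 'a set \<Rightarrow> bool" where
  "countable_index G L \<longleftrightarrow> (\<exists>f :: 'a \<Rightarrow> nat. \<forall>g\<in>carrier G. \<forall>h\<in>carrier G.
     f g = f h \<longrightarrow> g \<otimes>\<^bsub>G\<^esub> inv\<^bsub>G\<^esub> h \<in> L)"

lemma countable_indexI:
  assumes "countable (f ` carrier G)"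
    and "\<And>g h. g \<in> carrier G \<Longrightarrow> h \<in> carrier G \<Longrightarrow> f g = f h \<Longrightarrow> g \<otimes>\<^bsub>G\<^esub> inv\<^bsub>G\<^esub> h \<in> L"
  shows "countable_index G L"
  unfolding countable_index_def
proof (intro exI[of _ "\<lambda>g. to_nat_on (f ` carrier G) (f g)"] ballI impI)
  fix g h assume *: "g \<in> carrier G" "h \<in> carrier G"
    and "to_nat_on (f ` carrier G) (f g) = to_nat_on (f ` carrier G) (f h)"
  then have "f g = f h" using assms(1) by simp
  then show "g \<otimes>\<^bsub>G\<^esub> inv\<^bsub>G\<^esub> h \<in> L" using assms(2) * by blast
qed

lemma countable_index_mono: "countable_index G L \<Longrightarrow> L \<subseteq> M \<Longrightarrow> countable_index G M"
  unfolding countable_index_def by blast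

lemma countable_index_Int:
  assumes "countable_index G L" "countable_index G M"
  shows "countable_index G (L \<inter> M)"
proof -
  obtain f where f: "\<forall>g\<in>carrier G. \<forall>h\<in>carrier G. (f g :: nat) = f h \<longrightarrow> g \<otimes>\<^bsub>G\<^esub> inv\<^bsub>G\<^esub> h \<in> L"
    using assms(1) unfolding countable_index_def by auto
  obtain f' where f': "\<forall>g\<in>carrier G. \<forall>h\<in>carrier G. (f' g :: nat) = f' h \<longrightarrow> g \<otimes>\<^bsub>G\<^esub> inv\<^bsub>G\<^esub> h \<in> M"
    using assms(2) unfolding countable_index_def by auto
  show ?thesis
    by (rule countable_indexI[where f = "\<lambda>g. (f g, f' g)"]) (use f f' in auto)
qed

lemma (in group) countable_index_INT:
  assumes "finite I" "\<And>i. i \<in> I \<Longrightarrow> countable_index G (L i)"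
  shows "countable_index G (carrier G \<inter> (\<Inter>i\<in>I. L i))"
  using assms
proof (induction I)
  case empty
  show ?case by (rule countable_indexI[where f = "\<lambda>_. ()"]) auto
next
  case (insert i I)
  then have "countable_index G (L i \<inter> (carrier G \<inter> (\<Inter>i\<in>I. L i)))"
    using countable_index_Int[of G "L i" "carrier G \<inter> (\<Inter>i\<in>I. L i)"] by simp
  then show ?case by (rule countable_index_mono) auto
qed

lemma (in group) r_coset_eq_iff:
  assumes L: "subgroup L G" and g: "g \<in> carrier G" and h: "h \<in> carrier G"
  shows "L #> g = L #> h \<longleftrightarrow> g \<otimes> inv h \<in> L"
proof
  assume "L #> g = L #> h"
  then have "g \<in> L #> h" using rcos_self[OF g L] by simp
  then show "g \<otimes> inv h \<in> L" using subgroup.rcos_module[OF L] g h by (simp add: is_group)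
next
  assume "g \<otimes> inv h \<in> L"
  then have "g \<in> L #> h" using subgroup.rcos_module[OF L] g h by (simp add: is_group)
  then show "L #> g = L #> h" using repr_independence[OF _ _ L] h by simp
qed

lemma (in group) countable_index_iff:
  assumes L: "subgroup L G"
  shows "countable_index G L \<longleftrightarrow> countable (rcosets L)"
proof
  note eq = r_coset_eq_iff[OF L]
  have R: "rcosets L = (\<lambda>g. L #> g) ` carrier G" unfolding RCOSETS_def by auto
  show "countable_index G L" if "countable (rcosets L)"
    by (rule countable_indexI[where f = "\<lambda>g. L #> g"]) (use that R eq in auto)
  show "countable (rcosets L)" if ci: "countable_index G L"
  proof -
    obtain f where f: "\<forall>g\<in>carrier G. \<forall>h\<in>carrier G. (f g :: nat) = f h \<longrightarrow> g \<otimes> inv h \<in> L"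
      using ci unfolding countable_index_def by auto
    define r where "r U = (SOME g. g \<in> carrier G \<and> L #> g = U)" for U
    have r: "r U \<in> carrier G \<and> L #> r U = U" if U: "U \<in> rcosets L" for U
      unfolding r_def by (rule someI_ex) (use U R in auto)
    have "inj_on (\<lambda>U. f (r U)) (rcosets L)"
      by (rule inj_onI) (metis r f eq)
    then show ?thesis by (rule countableI)
  qed
qed

text \<open>Every word involves finitely many generators. Together with local finiteness this makes
  the subgroup generated by a countable set countable.\<close>

lemma (in group) generate_eq_finite_Union:
  "generate G Y = (\<Union>F\<in>{F. finite F \<and> F \<subseteq> Y}. generate G F)"
proof
  show "generate G Y \<subseteq> (\<Union>F\<in>{F. finite F \<and> F \<subseteq> Y}. generate G F)"
  proof
    fix x assume "x \<in> generate G Y"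
    then show "x \<in> (\<Union>F\<in>{F. finite F \<and> F \<subseteq> Y}. generate G F)"
    proof induction
      case one
      show ?case using generate.one[of G "{}"] by blast
    next
      case (incl h)
      then show ?case using generate.incl[of h "{h}" G] by blast
    next
      case (inv h)
      then show ?case using generate.inv[of h "{h}" G] by blast
    next
      case (eng x y)
      then obtain E F where *: "finite E" "E \<subseteq> Y" "x \<in> generate G E" "finite F" "F \<subseteq> Y" "y \<in> generate G F"
        by blast
      then have "x \<otimes> y \<in> generate G (E \<union> F)"
        using mono_generate[of E "E \<union> F"] mono_generate[of F "E \<union> F"] by (auto intro: generate.eng)
      then show ?case using * by blast
    qed
  qed
qed (use mono_generate in blast)

lemma (in group) subgroup_centralizer:
  assumes "Y \<subseteq> carrier G"
  shows "subgroup (centralizer G Y) G"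
proof
  show "centralizer G Y \<subseteq> carrier G" "\<one> \<in> centralizer G Y"
    using assms by (auto simp: centralizer_def)
  show "x \<otimes> y \<in> centralizer G Y" if "x \<in> centralizer G Y" "y \<in> centralizer G Y" for x y
    using that assms by (auto simp: centralizer_def subset_iff) (metis m_assoc)
  show "inv x \<in> centralizer G Y" if "x \<in> centralizer G Y" for x
  proof -
    have "inv x \<otimes> h = h \<otimes> inv x" if "h \<in> Y" for h
    proof -
      have c: "x \<in> carrier G" "h \<in> carrier G" "x \<otimes> h = h \<otimes> x"
        using that \<open>x \<in> centralizer G Y\<close> assms by (auto simp: centralizer_def)
      have "inv x \<otimes> h = inv x \<otimes> (h \<otimes> x) \<otimes> inv x" using c(1,2) by (simp add: m_assoc)
      also have "\<dots> = h \<otimes> inv x" unfolding c(3)[symmetric] using c(1,2) by (simp add: m_assoc[symmetric])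
      finally show ?thesis .
    qed
    then show ?thesis using that by (auto simp: centralizer_def)
  qed
qed

lemma (in group) commutator_closed [simp]:
  "x \<in> carrier G \<Longrightarrow> y \<in> carrier G \<Longrightarrow> commutator G x y \<in> carrier G"
  by (simp add: commutator_def)

lemma (in group) commutator_in_derived:
  "x \<in> carrier G \<Longrightarrow> y \<in> carrier G \<Longrightarrow> commutator G x y \<in> derived G (carrier G)"
  unfolding commutator_def derived_def by (intro generate.incl) blast

lemma (in group) commutator_swap:
  "x \<in> carrier G \<Longrightarrow> y \<in> carrier G \<Longrightarrow> commutator G y x = inv (commutator G x y)"
  by (simp add: commutator_def inv_mult_group m_assoc)

lemma (in group) commutator_eq_one_iff:
  assumes "x \<in> carrier G" "y \<in> carrier G"
  shows "commutator G x y = \<one> \<longleftrightarrow> x \<otimes> y = y \<otimes> x"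
proof -
  have "commutator G x y = x \<otimes> y \<otimes> inv (y \<otimes> x)"
    using assms by (simp add: commutator_def inv_mult_group m_assoc)
  then show ?thesis using assms by (metis inv_equality inv_inv m_closed r_inv inv_closed)
qed

lemma (in group) normalizer_conj:
  assumes "subgroup K G" "g \<in> normalizer G K"
  shows "g \<in> carrier G" "k \<in> K \<Longrightarrow> g \<otimes> k \<otimes> inv g \<in> K"
proof -
  show g: "g \<in> carrier G" using assms(2) unfolding normalizer_def stabilizer_def by auto
  have "g <# K #> inv g = K"
    using assms unfolding normalizer_def stabilizer_def by (auto simp: subgroup.subset)
  then show "k \<in> K \<Longrightarrow> g \<otimes> k \<otimes> inv g \<in> K" unfolding l_coset_def r_coset_def by blast
qed

lemma (in group) centralizer_subset_normalizer:
  assumes "subgroup H G"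
  shows "centralizer G H \<subseteq> normalizer G H"
proof
  fix g assume g: "g \<in> centralizer G H"
  then have gc: "g \<in> carrier G" by (simp add: centralizer_def)
  have Hc: "H \<subseteq> carrier G" using assms by (rule subgroup.subset)
  have "g \<otimes> h \<otimes> inv g = h" if "h \<in> H" for h
    using g that gc Hc by (auto simp: centralizer_def m_assoc subset_iff)
  then have "g <# H #> inv g = H" unfolding l_coset_def r_coset_def by auto
  then show "g \<in> normalizer G H"
    using gc Hc unfolding normalizer_def stabilizer_def by auto
qed

section \<open>The commutator form on \<open>C\<close> and its orthogonal complements\<close>

text \<open>The last assumption is the condition of \<open>class_Y\<close> at the first uncountable
  cardinal.\<close>

locale finite_derived_Y = group G for G (structure) +
  assumes finite_derived: "finite (derived G (carrier G))"
    and locally_finite: "\<And>R. R \<subseteq> carrier G \<Longrightarrow> finite R \<Longrightarrow> finite (generate G R)"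
    and index_normalizer: "\<And>K. subgroup K G \<Longrightarrow> countable K \<Longrightarrow> countable_index G (normalizer G K)"
begin

definition C where "C = centralizer G (derived G (carrier G))"

definition T where "T = derived G (carrier G) \<inter> C"

text \<open>The commutator map is bimultiplicative from \<open>C \<times> C\<close> to the finite central subgroup \<open>T\<close>
  of \<open>C\<close>; \<open>perp S A\<close> is the orthogonal complement of \<open>A\<close> for this form read modulo \<open>S\<close>.\<close>

definition perp where "perp S A = {g \<in> C. \<forall>a\<in>A. commutator G a g \<in> S}"

lemma C_subgroup: "subgroup C G"
  unfolding C_def by (rule subgroup_centralizer) (simp add: derived_in_carrier)

lemma C_carrier [simp]: "x \<in> C \<Longrightarrow> x \<in> carrier G"
  using C_subgroup by (rule subgroup.mem_carrier)

lemma C_closed [simp]: "x \<in> C \<Longrightarrow> y \<in> C \<Longrightarrow> x \<otimes> y \<in> C" "x \<in> C \<Longrightarrow> inv x \<in> C" "\<one> \<in> C"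
  using C_subgroup by (auto simp: subgroup.m_closed subgroup.m_inv_closed subgroup.one_closed)

lemma T_subgroup: "subgroup T G"
  unfolding T_def
  by (intro subgroups_Inter_pair C_subgroup derived_is_subgroup) simp

lemma T_subset_C: "T \<subseteq> C"
  by (simp add: T_def)

lemma T_in_C [simp]: "t \<in> T \<Longrightarrow> t \<in> C"
  by (simp add: T_def)

lemma T_finite: "finite T"
  using finite_derived by (simp add: T_def)

lemma C_T_commute: "x \<in> C \<Longrightarrow> t \<in> T \<Longrightarrow> x \<otimes> t = t \<otimes> x"
  unfolding T_def C_def centralizer_def by blast

lemma commutator_in_T [simp]: "x \<in> C \<Longrightarrow> y \<in> C \<Longrightarrow> commutator G x y \<in> T"
  unfolding T_def using commutator_in_derived[of x y] by (simp add: commutator_def)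

lemma commutator_T: "t \<in> T \<Longrightarrow> x \<in> C \<Longrightarrow> commutator G t x = \<one>" "t \<in> T \<Longrightarrow> x \<in> C \<Longrightarrow> commutator G x t = \<one>"
  by (simp_all add: commutator_eq_one_iff C_T_commute)

text \<open>The factor \<open>commutator G y z\<close> lies in \<open>T\<close>, whose elements
  commute with all of \<open>C\<close>, so conjugation by \<open>x\<close> does not change
  it.\<close>

lemma commutator_mult_left:
  assumes "x \<in> C" "y \<in> C" "z \<in> C"
  shows "commutator G (x \<otimes> y) z = commutator G x z \<otimes> commutator G y z"
proof -
  have c: "x \<in> carrier G" "y \<in> carrier G" "z \<in> carrier G" using assms by auto
  define k where "k = commutator G y z"
  have k: "k \<in> T" "k \<in> carrier G" using assms by (simp_all add: k_def)
  have yz: "y \<otimes> z \<otimes> inv y = k \<otimes> z" using c by (simp add: k_def commutator_def m_assoc)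
  have "commutator G (x \<otimes> y) z = x \<otimes> (y \<otimes> z \<otimes> inv y) \<otimes> inv x \<otimes> inv z"
    using c by (simp add: commutator_def inv_mult_group m_assoc)
  also have "\<dots> = (x \<otimes> k) \<otimes> z \<otimes> inv x \<otimes> inv z" unfolding yz using c k by (simp add: m_assoc)
  also have "\<dots> = k \<otimes> commutator G x z"
    unfolding C_T_commute[OF assms(1) k(1)] using c k by (simp add: commutator_def m_assoc)
  also have "\<dots> = commutator G x z \<otimes> commutator G y z"
    using C_T_commute[of k "commutator G x z"] assms k by (simp add: k_def)
  finally show ?thesis .
qed

lemma T_comm_group: "comm_group (G\<lparr>carrier := T\<rparr>)"
proof -
  interpret T: group "G\<lparr>carrier := T\<rparr>" using T_subgroup by (rule subgroup_imp_group)
  show ?thesis by (rule T.group_comm_groupI) (simp add: C_T_commute)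
qed

text \<open>Packaged as a homomorphism so that the general rule for integer powers applies.\<close>

lemma commutator_hom:
  assumes "z \<in> C"
  shows "group_hom (G\<lparr>carrier := C\<rparr>) (G\<lparr>carrier := T\<rparr>) (\<lambda>x. commutator G x z)"
proof -
  interpret T: comm_group "G\<lparr>carrier := T\<rparr>" by (rule T_comm_group)
  interpret C: group "G\<lparr>carrier := C\<rparr>" using C_subgroup by (rule subgroup_imp_group)
  show ?thesis
    by unfold_locales (use assms in \<open>auto simp: hom_def commutator_mult_left\<close>)
qed

lemma commutator_int_pow:
  assumes "x \<in> C" "z \<in> C"
  shows "commutator G (x [^] (j::int)) z = commutator G x z [^] j"
  unfolding int_pow_consistent[OF C_subgroup assms(1)]
    int_pow_consistent[OF T_subgroup commutator_in_T[OF assms]]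
  by (rule group_hom.hom_int_pow[OF commutator_hom[OF assms(2)]]) (simp add: assms)

lemma commutator_inv_left:
  assumes "x \<in> C" "z \<in> C"
  shows "commutator G (inv x) z = inv (commutator G x z)"
  using commutator_int_pow[OF assms, of "-1"] assms by (simp add: int_pow_neg)

lemma perp_subgroup_left:
  assumes S: "subgroup S G" and z: "z \<in> C"
  shows "subgroup {x \<in> C. commutator G x z \<in> S} G"
proof
  show "\<one> \<in> {x \<in> C. commutator G x z \<in> S}"
    using S z by (simp add: commutator_def subgroup.one_closed)
qed (use S z in \<open>auto simp: commutator_mult_left commutator_inv_left subgroup.m_closed subgroup.m_inv_closed\<close>)

lemma commutator_swap_mem:
  assumes "subgroup S G" "x \<in> carrier G" "y \<in> carrier G"
  shows "commutator G x y \<in> S \<longleftrightarrow> commutator G y x \<in> S"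
  using assms by (metis commutator_swap subgroup.m_inv_closed)

lemma perp_subgroup:
  assumes S: "subgroup S G" and A: "A \<subseteq> C"
  shows "subgroup (perp S A) G"
proof -
  have sw: "commutator G a x \<in> S \<longleftrightarrow> commutator G x a \<in> S" if "a \<in> A" "x \<in> C" for a x
    by (rule commutator_swap_mem[OF S]) (use that A in auto)
  have "perp S A = (\<Inter>(insert C ((\<lambda>a. {x \<in> C. commutator G x a \<in> S}) ` A)))"
    by (auto simp: perp_def sw)
  moreover have "subgroup \<dots> G"
    by (rule subgroups_Inter) (use C_subgroup perp_subgroup_left[OF S] A in auto)
  ultimately show ?thesis by simp
qed

lemma perp_subset_C: "perp S A \<subseteq> C"
  by (auto simp: perp_def)

text \<open>Swapping the arguments inverts a commutator, and \<open>S\<close> is closed under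
  inverses. Orthogonality is thus a symmetric relation and \<open>perp S\<close> a Galois connection
  with itself.\<close>

lemma perp_sym:
  assumes "subgroup S G" "A \<subseteq> C" "B \<subseteq> C"
  shows "A \<subseteq> perp S B \<longleftrightarrow> B \<subseteq> perp S A"
proof -
  have "commutator G a b \<in> S \<longleftrightarrow> commutator G b a \<in> S" if "a \<in> A" "b \<in> B" for a b
    using commutator_swap_mem[OF assms(1)] that assms(2,3) by (meson C_carrier subsetD)
  then show ?thesis unfolding perp_def using assms(2,3) by blast
qed

lemma perp_Un: "perp S (A \<union> B) = perp S A \<inter> perp S B"
  by (auto simp: perp_def)

lemma perp_antimono: "A \<subseteq> B \<Longrightarrow> perp S B \<subseteq> perp S A"
  by (auto simp: perp_def)

text \<open>The double complement of \<open>A\<close> is a subgroup containing \<open>A\<close>,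
  hence contains \<open>generate G A\<close>.\<close>

lemma perp_generate:
  assumes S: "subgroup S G" and A: "A \<subseteq> C"
  shows "perp S (generate G A) = perp S A"
proof
  show "perp S (generate G A) \<subseteq> perp S A"
    by (rule perp_antimono) (auto intro: generate.incl)
  have gC: "generate G A \<subseteq> C" using generate_subgroup_incl[OF A C_subgroup] .
  have "A \<subseteq> perp S (perp S A)" using perp_sym[OF S A perp_subset_C] by blast
  then have "generate G A \<subseteq> perp S (perp S A)"
    by (rule generate_subgroup_incl) (rule perp_subgroup[OF S perp_subset_C])
  then show "perp S A \<subseteq> perp S (generate G A)" using perp_sym[OF S gC perp_subset_C] by blast
qed

lemma T_subset_perp:
  assumes "subgroup S G" "A \<subseteq> C"
  shows "T \<subseteq> perp S A"
  using assms by (auto simp: perp_def commutator_T subset_iff subgroup.one_closed)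

section \<open>Centralizers and complements of finite sets\<close>

text \<open>All conjugates of \<open>a\<close> lie in the finite coset of the derived subgroup
  through \<open>a\<close>. The map \<open>\<phi>\<close> records how \<open>g\<close> conjugates
  the elements of \<open>A\<close>, so it has finitely many values and separates the cosets of the
  centralizer.\<close>

lemma finite_index_centralizer:
  assumes "finite A" "A \<subseteq> carrier G"
  obtains \<phi> :: "'a \<Rightarrow> 'a \<Rightarrow> 'a" where "finite (\<phi> ` carrier G)"
    "\<And>g h. g \<in> carrier G \<Longrightarrow> h \<in> carrier G \<Longrightarrow> \<phi> g = \<phi> h \<Longrightarrow> g \<otimes> inv h \<in> centralizer G A"
proof -
  define \<phi> where "\<phi> g = restrict (\<lambda>a. inv g \<otimes> a \<otimes> g) A" for g
  define V where "V = (\<lambda>(d, a). d \<otimes> a) ` (derived G (carrier G) \<times> A)"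
  have "inv g \<otimes> a \<otimes> g \<in> V" if "g \<in> carrier G" "a \<in> A" for g a
  proof -
    have "a \<in> carrier G" using that assms(2) by blast
    then have "inv g \<otimes> a \<otimes> g = commutator G (inv g) a \<otimes> a"
      using that(1) by (simp add: commutator_def m_assoc)
    then show ?thesis
      using commutator_in_derived[of "inv g" a] that assms(2) by (auto simp: V_def)
  qed
  then have "\<phi> ` carrier G \<subseteq> A \<rightarrow>\<^sub>E V" by (auto simp: \<phi>_def)
  moreover have "finite V" using finite_derived assms(1) by (simp add: V_def)
  ultimately have 1: "finite (\<phi> ` carrier G)"
    using assms(1) by (meson finite_PiE finite_subset)
  have 2: "g \<otimes> inv h \<in> centralizer G A" if gh: "g \<in> carrier G" "h \<in> carrier G" "\<phi> g = \<phi> h" for g h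
  proof -
    have "g \<otimes> inv h \<otimes> a = a \<otimes> (g \<otimes> inv h)" if a: "a \<in> A" for a
    proof -
      have ac: "a \<in> carrier G" using a assms by auto
      have e: "inv g \<otimes> a \<otimes> g = inv h \<otimes> a \<otimes> h" using gh(3) a by (metis \<phi>_def restrict_apply')
      have "a \<otimes> (g \<otimes> inv h) = g \<otimes> (inv g \<otimes> a \<otimes> g) \<otimes> inv h"
        using gh ac by (simp add: m_assoc[symmetric])
      also have "\<dots> = g \<otimes> inv h \<otimes> a" unfolding e using gh ac by (simp add: m_assoc)
      finally show ?thesis by simp
    qed
    then show ?thesis using gh by (simp add: centralizer_def)
  qed
  show thesis using that[OF 1] 2 by blast
qed

lemma countable_index_centralizer:
  assumes "finite A" "A \<subseteq> carrier G"
  shows "countable_index G (centralizer G A)"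
proof -
  obtain \<phi> :: "'a \<Rightarrow> 'a \<Rightarrow> 'a" where \<phi>: "finite (\<phi> ` carrier G)"
    "\<And>g h. g \<in> carrier G \<Longrightarrow> h \<in> carrier G \<Longrightarrow> \<phi> g = \<phi> h \<Longrightarrow> g \<otimes> inv h \<in> centralizer G A"
    using finite_index_centralizer[OF assms(1,2)] by blast
  show ?thesis by (rule countable_indexI[OF countable_finite[OF \<phi>(1)] \<phi>(2)])
qed

lemma finite_transversal_centralizer:
  assumes "finite A" "A \<subseteq> carrier G" "H \<subseteq> carrier G"
  obtains F where "finite F" "F \<subseteq> H" "\<And>h. h \<in> H \<Longrightarrow> \<exists>f\<in>F. h \<otimes> inv f \<in> centralizer G A"
proof -
  obtain \<phi> :: "'a \<Rightarrow> 'a \<Rightarrow> 'a" where \<phi>: "finite (\<phi> ` carrier G)"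
    "\<And>g h. g \<in> carrier G \<Longrightarrow> h \<in> carrier G \<Longrightarrow> \<phi> g = \<phi> h \<Longrightarrow> g \<otimes> inv h \<in> centralizer G A"
    using finite_index_centralizer[OF assms(1,2)] by blast
  have "finite (\<phi> ` H)" using \<phi>(1) assms(3) by (meson finite_subset image_mono)
  then obtain F where F: "F \<subseteq> H" "finite F" "\<phi> ` H = \<phi> ` F"
    using finite_subset_image[of "\<phi> ` H" \<phi> H] by blast
  have "\<exists>f\<in>F. h \<otimes> inv f \<in> centralizer G A" if h: "h \<in> H" for h
  proof -
    obtain f where "f \<in> F" "\<phi> h = \<phi> f" using h F(3) by blast
    then show ?thesis using \<phi>(2) h F(1) assms(3) by blast
  qed
  then show thesis using that F by blast
qed

lemma countable_index_C: "countable_index G C"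
  unfolding C_def by (rule countable_index_centralizer[OF finite_derived]) (simp add: derived_in_carrier)

lemma countable_index_perp_finite:
  assumes "subgroup S G" "finite A" "A \<subseteq> C"
  shows "countable_index G (perp S A)"
proof (rule countable_index_mono)
  show "countable_index G (C \<inter> centralizer G A)"
    using assms by (intro countable_index_Int countable_index_C countable_index_centralizer) auto
  have "commutator G a g \<in> S" if "g \<in> C" "g \<in> centralizer G A" "a \<in> A" for a g
  proof -
    have "commutator G a g = \<one>"
      using that assms(3) by (subst commutator_eq_one_iff) (auto simp: centralizer_def)
    then show ?thesis using assms(1) by (simp add: subgroup.one_closed)
  qed
  then show "C \<inter> centralizer G A \<subseteq> perp S A" by (auto simp: perp_def)
qed

section \<open>Complements of countable isotropic sets\<close>

lemma countable_generate:
  assumes "A \<subseteq> carrier G" "countable A"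
  shows "countable (generate G A)"
proof -
  have "countable (\<Union>F\<in>{F. finite F \<and> F \<subseteq> A}. generate G F)"
  proof (rule countable_UN)
    show "countable {F. finite F \<and> F \<subseteq> A}"
      using assms(2) by (rule countable_Collect_finite_subset)
    show "countable (generate G F)" if "F \<in> {F. finite F \<and> F \<subseteq> A}" for F
      using that assms(1) locally_finite[of F] countable_finite by blast
  qed
  then show ?thesis by (simp add: generate_eq_finite_Union[of A])
qed

text \<open>By bimultiplicativity, the \<open>card T\<close>-th power of an element of
  \<open>C\<close> commutes with all of \<open>C\<close>.\<close>

lemma card_T_pow:
  assumes "t \<in> T" shows "t [^] card T = \<one>"
proof -
  interpret T: group "G\<lparr>carrier := T\<rparr>" using T_subgroup by (rule subgroup_imp_group)
  show ?thesis using T.pow_order_eq_1[of t] assms by (simp add: order_def nat_pow_consistent[symmetric])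
qed

text \<open>If \<open>K\<close> is maximal among the subgroups of \<open>A\<close> with \<open>K \<inter> T = S\<close>, then the normalizer of \<open>K\<close>
  in \<open>C\<close> centralizes \<open>K\<close> modulo \<open>S\<close>, and \<open>A / K\<close> has finite socle, so that \<open>A\<close> is generated by \<open>K\<close>,
  the \<open>|T|\<close>-th powers (which commute with \<open>C\<close>) and finitely many elements.\<close>

lemma countable_index_perp_isotropic:
  assumes S: "subgroup S G" "S \<subseteq> T" and B: "B \<subseteq> C" "countable B" "B \<subseteq> perp S B"
  shows "countable_index G (perp S B)"
proof -
  \<comment> \<open>Adjoining \<open>S\<close> keeps the set isotropic, as \<open>T\<close> lies in
    the complement of every subset of \<open>C\<close>. It also makes \<open>S\<close> a member of
    the family to which Zorn's lemma is applied.\<close>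
  define A where "A = generate G (B \<union> S)"
  have BS: "B \<union> S \<subseteq> C" using B(1) S(2) T_subset_C by blast
  have AC: "A \<subseteq> C" unfolding A_def by (rule generate_subgroup_incl[OF BS C_subgroup])
  have BSc: "B \<union> S \<subseteq> carrier G" using BS C_carrier by blast
  have A: "subgroup A G" unfolding A_def by (rule generate_is_subgroup[OF BSc])
  have A_sub: "B \<subseteq> A" "S \<subseteq> A" unfolding A_def by (auto intro: generate.incl)
  have "countable S" using S(2) T_finite by (meson countable_finite finite_subset)
  then have A_countable: "countable A"
    unfolding A_def using B(2) by (intro countable_generate[OF BSc]) simp
  have SC: "S \<subseteq> C" using BS by blast
  have "B \<subseteq> perp S S"
    using perp_sym[OF S(1) SC B(1)] S(2) T_subset_perp[OF S(1) B(1)] by blast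
  then have "B \<union> S \<subseteq> perp S (B \<union> S)"
    using B(3) S(2) T_subset_perp[OF S(1) BS] unfolding perp_Un by blast
  then have A_iso: "A \<subseteq> perp S A"
    using generate_subgroup_incl[OF _ perp_subgroup[OF S(1) BS]] perp_generate[OF S(1) BS]
    unfolding A_def by blast
  have A_comm: "commutator G a b \<in> S" if "a \<in> A" "b \<in> A" for a b
    using A_iso that unfolding perp_def by blast
  define \<K> where "\<K> = {K. subgroup K G \<and> S \<subseteq> K \<and> K \<subseteq> A \<and> K \<inter> T \<subseteq> S}"
  have "\<exists>K\<in>\<K>. \<forall>L\<in>\<K>. K \<subseteq> L \<longrightarrow> L = K"
  proof (rule subset_Zorn_nonempty)
    have "S \<in> \<K>" using S A_sub by (auto simp: \<K>_def)
    then show "\<K> \<noteq> {}" by blast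
    fix \<C> assume ne: "\<C> \<noteq> {}" and ch: "subset.chain \<K> \<C>"
    have mem: "subgroup K G" "S \<subseteq> K" "K \<subseteq> A" "K \<inter> T \<subseteq> S" if "K \<in> \<C>" for K
      using ch that by (auto simp: subset.chain_def \<K>_def)
    have "subgroup (\<Union>\<C>) G"
    proof
      show "\<Union>\<C> \<subseteq> carrier G" using subgroup.subset[OF mem(1)] by blast
      show "\<one> \<in> \<Union>\<C>" using ne subgroup.one_closed[OF mem(1)] by blast
      show "inv x \<in> \<Union>\<C>" if "x \<in> \<Union>\<C>" for x
        using that subgroup.m_inv_closed[OF mem(1)] by (meson UnionE UnionI)
      show "x \<otimes> y \<in> \<Union>\<C>" if xy: "x \<in> \<Union>\<C>" "y \<in> \<Union>\<C>" for x y
      proof -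
        obtain K L where KL: "K \<in> \<C>" "L \<in> \<C>" "x \<in> K" "y \<in> L" using xy by blast
        then have "K \<subseteq> L \<or> L \<subseteq> K" using ch by (auto simp: subset.chain_def)
        then obtain M where "M \<in> \<C>" "x \<in> M" "y \<in> M" using KL by blast
        then show ?thesis using subgroup.m_closed[OF mem(1)] by blast
      qed
    qed
    moreover have "S \<subseteq> \<Union>\<C>" using ne mem(2) by blast
    moreover have "\<Union>\<C> \<subseteq> A" "\<Union>\<C> \<inter> T \<subseteq> S" using mem(3,4) by blast+
    ultimately show "\<Union>\<C> \<in> \<K>" by (simp add: \<K>_def)
  qed
  then obtain K where K_mem: "K \<in> \<K>" and K_maximal: "\<forall>L\<in>\<K>. K \<subseteq> L \<longrightarrow> L = K" by (rule bexE)
  have K: "subgroup K G" "S \<subseteq> K" "K \<subseteq> A" "K \<inter> T \<subseteq> S" using K_mem by (simp_all add: \<K>_def)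
  have K_max: "L = K" if "subgroup L G" "S \<subseteq> L" "L \<subseteq> A" "L \<inter> T \<subseteq> S" "K \<subseteq> L" for L
    using K_maximal that by (simp add: \<K>_def)
  have KC: "K \<subseteq> C" using K(3) AC by blast
  have perp_K: "countable_index G (perp S K)"
  proof (rule countable_index_mono)
    have "countable K" using K(3) A_countable by (rule countable_subset)
    then show "countable_index G (C \<inter> normalizer G K)"
      by (intro countable_index_Int countable_index_C index_normalizer[OF K(1)])
    \<comment> \<open>The commutator is \<open>k\<close> times a conjugate of \<open>inv k\<close>
      by an element of the normalizer, so it lies in \<open>K\<close>; it also lies in
      \<open>T\<close>, and \<open>K \<inter> T\<close> is inside \<open>S\<close>.\<close>
    have "commutator G k g \<in> S" if "g \<in> C" "g \<in> normalizer G K" "k \<in> K" for k g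
    proof -
      have kc: "k \<in> carrier G" using that(3) KC by auto
      have "g \<otimes> inv k \<otimes> inv g \<in> K"
        using normalizer_conj(2)[OF K(1) that(2)] subgroup.m_inv_closed[OF K(1) that(3)] by blast
      then have "k \<otimes> (g \<otimes> inv k \<otimes> inv g) \<in> K" using subgroup.m_closed[OF K(1) that(3)] by blast
      then have "commutator G k g \<in> K" using kc that(1) by (simp add: commutator_def m_assoc)
      then show ?thesis using K(4) commutator_in_T[of k g] that(1,3) KC by blast
    qed
    then show "C \<inter> normalizer G K \<subseteq> perp S K" unfolding perp_def by blast
  qed

  define A' where "A' = G\<lparr>carrier := A\<rparr>"
  have A'_simps [simp]: "carrier A' = A" "monoid.mult A' = monoid.mult G" "one A' = \<one>" by (simp_all add: A'_def)
  interpret A': group A' unfolding A'_def using A by (rule subgroup_imp_group)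
  have inv_A': "inv\<^bsub>A'\<^esub> a = inv a" if "a \<in> A" for a
    unfolding A'_def using m_inv_consistent[OF A that] .
  have K_A': "subgroup K A'" unfolding A'_def using subgroup_incl[OF K(1) A K(3)] .
  have "a \<otimes>\<^bsub>A'\<^esub> k \<otimes>\<^bsub>A'\<^esub> inv\<^bsub>A'\<^esub> a \<in> K" if "a \<in> A" "k \<in> K" for a k
  proof -
    have c: "a \<in> carrier G" "k \<in> carrier G" using that AC KC by auto
    have "a \<otimes> k \<otimes> inv a = commutator G a k \<otimes> k" using c by (simp add: commutator_def m_assoc)
    moreover have "commutator G a k \<in> K" using A_comm that K(2,3) by blast
    ultimately show ?thesis using that inv_A' subgroup.m_closed[OF K(1)] by simp
  qed
  then have "K \<lhd> A'" using A'.normal_inv_iff K_A' by auto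
  then interpret K: normal K A' .
  \<comment> \<open>Commutators of elements of \<open>A\<close> fall into \<open>S\<close>, hence
    into \<open>K\<close>; this is why \<open>K\<close> is normal in \<open>A\<close> and why the
    quotient \<open>Q\<close> is abelian.\<close>
  define Q where "Q = A' Mod K"
  define r where "r a = K #>\<^bsub>A'\<^esub> a" for a
  have r_hom: "r \<in> hom A' Q" unfolding r_def Q_def by (rule K.r_coset_hom_Mod)
  interpret Q: group Q unfolding Q_def by (rule K.factorgroup_is_group)
  interpret r: group_hom A' Q r by unfold_locales (rule r_hom)
  have Q_carrier: "carrier Q = r ` A" unfolding Q_def r_def carrier_FactGroup by simp
  have r_eq: "a \<otimes> inv b \<in> K" if "a \<in> A" "b \<in> A" "r a = r b" for a b
  proof -
    have "a \<in> K #>\<^bsub>A'\<^esub> b" using A'.rcos_self[of a K] K_A' that by (simp add: r_def)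
    then show ?thesis using K.rcos_module[of b a] that inv_A' by (simp add: A'.is_group)
  qed
  have r_K: "r a = \<one>\<^bsub>Q\<^esub> \<longleftrightarrow> a \<in> K" if "a \<in> A" for a
    unfolding Q_def r_def one_FactGroup
    using A'.coset_join1[of K a] A'.coset_join2[of a K] K_A' that K.subset by auto
  interpret Q: comm_group Q
  proof (rule Q.group_comm_groupI)
    fix p q assume "p \<in> carrier Q" "q \<in> carrier Q"
    then obtain a b where ab: "a \<in> A" "b \<in> A" "p = r a" "q = r b" unfolding Q_carrier by blast
    have c: "a \<in> carrier G" "b \<in> carrier G" using ab AC by auto
    have k: "commutator G a b \<in> K" using A_comm[OF ab(1,2)] K(2) by blast
    have "inv b \<otimes> (b \<otimes> a) = a" using c by (simp add: m_assoc[symmetric])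
    then have "a \<otimes> b = commutator G a b \<otimes> (b \<otimes> a)" using c by (simp add: commutator_def m_assoc)
    then have "r (a \<otimes> b) = r (commutator G a b) \<otimes>\<^bsub>Q\<^esub> r (b \<otimes> a)"
      using r.hom_mult[of "commutator G a b" "b \<otimes> a"] k K(3) ab subgroup.m_closed[OF A] by auto
    also have "\<dots> = r (b \<otimes> a)"
      using r_K[of "commutator G a b"] k K(3) ab subgroup.m_closed[OF A] r.hom_closed[of "b \<otimes> a"] by auto
    finally show "p \<otimes>\<^bsub>Q\<^esub> q = q \<otimes>\<^bsub>Q\<^esub> p"
      using r.hom_mult[of a b] r.hom_mult[of b a] ab by simp
  qed
  have TA: "subgroup (T \<inter> A) A'"
    unfolding A'_def by (rule subgroup_incl[OF subgroups_Inter_pair[OF T_subgroup A] A]) blast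
  \<comment> \<open>The preimage \<open>P\<close> of the subgroup generated by \<open>q\<close>
    properly contains \<open>K\<close>. Maximality of \<open>K\<close> forces \<open>P\<close> to
    contain an element of \<open>T\<close> outside \<open>S\<close>, and its image in
    \<open>Q\<close> is nontrivial.\<close>
  have socle: "\<exists>y\<in>generate Q {q}. y \<in> r ` (T \<inter> A) \<and> y \<noteq> \<one>\<^bsub>Q\<^esub>" if q: "q \<in> carrier Q" "q \<noteq> \<one>\<^bsub>Q\<^esub>" for q
  proof -
    obtain x where x: "x \<in> A" "q = r x" using q unfolding Q_carrier by blast
    have xK: "x \<notin> K" using r_K[OF x(1)] q x by blast
    define P where "P = {a \<in> A. r a \<in> generate Q {q}}"
    have gq: "subgroup (generate Q {q}) Q" using q(1) by (intro Q.generate_is_subgroup) simp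
    have P: "subgroup P G"
    proof
      show "P \<subseteq> carrier G" using subgroup.subset[OF A] by (auto simp: P_def)
      have "r \<one> = \<one>\<^bsub>Q\<^esub>" using r.hom_one by simp
      then show "\<one> \<in> P" using subgroup.one_closed[OF A] by (simp add: P_def generate.one)
      show "a \<otimes> b \<in> P" if "a \<in> P" "b \<in> P" for a b
        using that subgroup.m_closed[OF A] r.hom_mult[of a b] by (simp add: P_def generate.eng)
      show "inv a \<in> P" if "a \<in> P" for a
        using that subgroup.m_inv_closed[OF A] r.hom_inv[of a] inv_A'[of a] subgroup.m_inv_closed[OF gq]
        by (simp add: P_def)
    qed
    have KP: "K \<subseteq> P"
    proof
      fix k assume k: "k \<in> K"
      then have "r k = \<one>\<^bsub>Q\<^esub>" using r_K K(3) by blast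
      then show "k \<in> P" using k K(3) by (auto simp: P_def generate.one)
    qed
    have xP: "x \<in> P" using x by (simp add: P_def generate.incl)
    have "\<not> P \<inter> T \<subseteq> S" using K_max[OF P] KP K(2) xP xK by (auto simp: P_def)
    then obtain t where t: "t \<in> P" "t \<in> T" "t \<notin> S" by blast
    then have "t \<notin> K" using K(4) by blast
    then show ?thesis using t r_K[of t] by (auto simp: P_def)
  qed
  \<comment> \<open>This exponent makes commutators with \<open>m\<close>-th powers trivial, so in
    the decomposition of \<open>A\<close> below only \<open>K\<close> and the finite set
    \<open>F\<close> impose conditions.\<close>
  define m where "m = card T"
  have "m > 0" unfolding m_def using T_finite subgroup.one_closed[OF T_subgroup] card_gt_0_iff by blast
  then have tors: "finite {q \<in> carrier Q. q [^]\<^bsub>Q\<^esub> m = \<one>\<^bsub>Q\<^esub>}"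
    using Q.finite_torsion_if_finite_socle[of "r ` (T \<inter> A)" m] socle T_finite
      r.subgroup_img_is_subgroup[OF TA] by blast
  have Q_lf: "finite (generate Q R)" if R: "R \<subseteq> carrier Q" "finite R" for R
  proof -
    obtain R' where R': "R' \<subseteq> A" "finite R'" "R = r ` R'"
      using finite_subset_image[OF R(2)] R(1) unfolding Q_carrier by blast
    have "generate Q R = r ` generate A' R'" using r.generate_img[of R'] R' by simp
    also have "generate A' R' = generate G R'" unfolding A'_def by (rule generate_consistent[OF R'(1) A])
    finally show ?thesis using locally_finite[of R'] R' subgroup.subset[OF A] by auto
  qed
  obtain F' where F': "finite F'" "F' \<subseteq> carrier Q"
    "\<And>q. q \<in> carrier Q \<Longrightarrow> \<exists>f\<in>F'. \<exists>y\<in>carrier Q. q = y [^]\<^bsub>Q\<^esub> m \<otimes>\<^bsub>Q\<^esub> f"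
    using Q.finite_mod_powers[OF Q_lf tors] by blast
  obtain F where F: "F \<subseteq> A" "finite F" "F' = r ` F"
    using finite_subset_image[OF F'(1)] F'(2) unfolding Q_carrier by blast
  have decomp: "\<exists>k\<in>K. \<exists>b\<in>A. \<exists>f\<in>F. a = k \<otimes> (b [^] m \<otimes> f)" if a: "a \<in> A" for a
  proof -
    have "r a \<in> carrier Q" using a Q_carrier by blast
    then obtain f b where fb: "f \<in> F" "b \<in> A" "r a = r b [^]\<^bsub>Q\<^esub> m \<otimes>\<^bsub>Q\<^esub> r f"
      using F'(3) unfolding F(3) Q_carrier by blast
    have bm: "b [^] m \<in> A" using subgroup_int_pow_closed[OF A fb(2), of "int m"] by (simp add: int_pow_int)
    have "r (b [^]\<^bsub>A'\<^esub> m) = r b [^]\<^bsub>Q\<^esub> m" using r.hom_nat_pow fb(2) by simp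
    moreover have "b [^]\<^bsub>A'\<^esub> m = b [^] m" unfolding A'_def by (simp add: nat_pow_consistent[symmetric])
    ultimately have ra: "r a = r (b [^] m \<otimes> f)" using fb bm F(1) r.hom_mult[of "b [^] m" f] by auto
    have bf: "b [^] m \<otimes> f \<in> A" using bm fb F(1) subgroup.m_closed[OF A] by blast
    have "a \<otimes> inv (b [^] m \<otimes> f) \<in> K" by (rule r_eq[OF a bf ra])
    moreover have "a = a \<otimes> inv (b [^] m \<otimes> f) \<otimes> (b [^] m \<otimes> f)"
      using a bf subgroup.mem_carrier[OF A] by (simp add: m_assoc)
    ultimately show ?thesis using fb by blast
  qed
  show ?thesis
  proof (rule countable_index_mono)
    show "countable_index G (perp S K \<inter> perp S F)"
      by (intro countable_index_Int perp_K countable_index_perp_finite S F(2)) (use F(1) AC in blast)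
    show "perp S K \<inter> perp S F \<subseteq> perp S B"
    proof
      fix g assume g: "g \<in> perp S K \<inter> perp S F"
      then have gC: "g \<in> C" by (simp add: perp_def)
      have sub: "subgroup {x \<in> C. commutator G x g \<in> S} G" (is "subgroup ?P G")
        by (rule perp_subgroup_left[OF S(1) gC])
      have "a \<in> ?P" if "a \<in> A" for a
      proof -
        obtain k b f where *: "k \<in> K" "b \<in> A" "f \<in> F" "a = k \<otimes> (b [^] m \<otimes> f)"
          using decomp[OF \<open>a \<in> A\<close>] by blast
        have bC: "b \<in> C" using *(2) AC by blast
        have "k \<in> ?P" "f \<in> ?P" using * g KC F(1) AC by (auto simp: perp_def)
        moreover have "b [^] m \<in> ?P"
        proof -
          have "commutator G (b [^] m) g = commutator G b g [^] m"
            using commutator_int_pow[OF bC gC, of "int m"] by (simp add: int_pow_int)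
          also have "\<dots> = \<one>" unfolding m_def using bC gC by (simp add: card_T_pow)
          finally have "commutator G (b [^] m) g \<in> S" using S(1) by (simp add: subgroup.one_closed)
          moreover have "b [^] m \<in> C"
            using subgroup_int_pow_closed[OF C_subgroup bC, of "int m"] by (simp add: int_pow_int)
          ultimately show ?thesis by simp
        qed
        ultimately show ?thesis unfolding *(4) using subgroup.m_closed[OF sub] by blast
      qed
      then show "g \<in> perp S B" using gC A_sub(1) by (auto simp: perp_def)
    qed
  qed
qed

section \<open>Uniserial quotients of \<open>T\<close> and generation by isotropic sets\<close>

lemma commutator_self: "x \<in> carrier G \<Longrightarrow> commutator G x x = \<one>"
  by (simp add: commutator_eq_one_iff)

text \<open>Integer powers of elements of \<open>T\<close> are the same in \<open>T\<close> and in
  \<open>G\<close>, so the results on abelian groups can be used for \<open>T\<close>.\<close>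

lemma pow_coset_T:
  assumes S: "subgroup S G" "S \<subseteq> T" and v: "v \<in> T"
  shows "subgroup (pow_coset G S v) (G\<lparr>carrier := T\<rparr>)" "pow_coset G S v \<subseteq> T"
    "S \<subseteq> pow_coset G S v" "v \<in> pow_coset G S v"
    "u \<in> pow_coset G S v \<Longrightarrow> pow_coset G S u \<subseteq> pow_coset G S v"
proof -
  interpret T: comm_group "G\<lparr>carrier := T\<rparr>" by (rule T_comm_group)
  have eq: "pow_coset G S w = pow_coset (G\<lparr>carrier := T\<rparr>) S w" if "w \<in> T" for w
    unfolding pow_coset_def int_pow_consistent[OF T_subgroup that] by simp
  have S': "subgroup S (G\<lparr>carrier := T\<rparr>)" by (rule subgroup_incl[OF S(1) T_subgroup S(2)])
  show 1: "subgroup (pow_coset G S v) (G\<lparr>carrier := T\<rparr>)" "S \<subseteq> pow_coset G S v" "v \<in> pow_coset G S v"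
    using T.pow_coset_subgroup[OF S', of v] v by (simp_all add: eq)
  show 2: "pow_coset G S v \<subseteq> T" using subgroup.subset[OF 1(1)] by simp
  show "pow_coset G S u \<subseteq> pow_coset G S v" if "u \<in> pow_coset G S v"
    using T.pow_coset_least[OF 1(1,2) that] eq[of u] that 2 by blast
qed

text \<open>As \<open>T\<close> is finite, some \<open>S\<close> is maximal among its subgroups
  avoiding \<open>t\<close>. Every larger subgroup of \<open>T\<close> then contains
  \<open>t\<close>, which is the hypothesis of \<open>uniserial_mod\<close>.\<close>

lemma maximal_avoiding_uniserial:
  assumes "t \<in> T" "t \<noteq> \<one>"
  obtains S where "subgroup S G" "S \<subseteq> T" "t \<notin> S"
    "\<And>u v. u \<in> T \<Longrightarrow> v \<in> T \<Longrightarrow> u \<in> pow_coset G S v \<or> v \<in> pow_coset G S u"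
proof -
  define \<R> where "\<R> = {R. subgroup R G \<and> R \<subseteq> T \<and> t \<notin> R}"
  have "\<R> \<subseteq> Pow T" by (auto simp: \<R>_def)
  then have fin: "finite \<R>" using T_finite by (meson finite_Pow_iff finite_subset)
  have "{\<one>} \<in> \<R>" using assms subgroup.one_closed[OF T_subgroup] triv_subgroup by (simp add: \<R>_def)
  then obtain S where S_mem: "S \<in> \<R>" and max: "\<And>R. R \<in> \<R> \<Longrightarrow> S \<subseteq> R \<Longrightarrow> S = R"
    using finite_has_maximal[OF fin] by auto
  have S: "subgroup S G" "S \<subseteq> T" "t \<notin> S" using S_mem by (simp_all add: \<R>_def)
  interpret T: comm_group "G\<lparr>carrier := T\<rparr>" by (rule T_comm_group)
  have mono: "t \<in> R" if "subgroup R (G\<lparr>carrier := T\<rparr>)" "S \<subset> R" for R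
  proof (rule ccontr)
    assume "t \<notin> R"
    moreover have "R \<subseteq> T" using subgroup.subset[OF that(1)] by simp
    moreover have "subgroup R G" using incl_subgroup[OF T_subgroup that(1)] .
    ultimately have "R \<in> \<R>" by (simp add: \<R>_def)
    then show False using max that(2) by blast
  qed
  have "u \<in> pow_coset G S v \<or> v \<in> pow_coset G S u" if uv: "u \<in> T" "v \<in> T" for u v
  proof -
    have "u \<in> pow_coset (G\<lparr>carrier := T\<rparr>) S v \<or> v \<in> pow_coset (G\<lparr>carrier := T\<rparr>) S u"
      by (rule T.uniserial_mod[where t = t])
        (use T_finite subgroup_incl[OF S(1) T_subgroup S(2)] assms S uv mono in simp_all)
    then show ?thesis
      unfolding pow_coset_def int_pow_consistent[OF T_subgroup uv(1)]
        int_pow_consistent[OF T_subgroup uv(2)] by simp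
  qed
  then show thesis using that S by blast
qed

text \<open>Splitting off hyperbolic pairs \<open>x, y\<close> for which \<open>[x, y]\<close> generates as large a subgroup
  of \<open>T / S\<close> as possible; uniseriality makes all other commutators multiples of \<open>[x, y]\<close>.\<close>

lemma finite_two_isotropic:
  assumes S: "subgroup S G" "S \<subseteq> T"
    and uni: "\<And>u v. u \<in> T \<Longrightarrow> v \<in> T \<Longrightarrow> u \<in> pow_coset G S v \<or> v \<in> pow_coset G S u"
    and D: "subgroup D G" "D \<subseteq> C" "finite D"
  shows "\<exists>A B. A \<subseteq> D \<and> B \<subseteq> D \<and> D \<subseteq> generate G (A \<union> B) \<and> A \<subseteq> perp S A \<and> B \<subseteq> perp S B"
  using D
proof (induction "card D" arbitrary: D rule: less_induct)
  case less
  note D = less.prems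
  define W where "W v = pow_coset G S v" for v
  note W = pow_coset_T[OF S, folded W_def]
  have W_fin: "finite (W v)" if "v \<in> T" for v
    using W(2)[OF that] T_finite finite_subset by blast
  have one: "\<one> \<in> S" using S(1) by (rule subgroup.one_closed)
  show ?case
  proof (cases "\<forall>u\<in>D. \<forall>v\<in>D. commutator G u v \<in> S")
    case True
    then have "D \<subseteq> perp S D" using D(2) by (auto simp: perp_def)
    moreover have "D \<subseteq> generate G (D \<union> {})" by (auto intro: generate.incl)
    ultimately show ?thesis by blast
  next
    case False
    define f where "f = (\<lambda>(u, v). card (W (commutator G u v)))"
    have DD: "finite (D \<times> D)" "D \<times> D \<noteq> {}" using D subgroup.one_closed[OF D(1)] by auto
    have "Max (f ` (D \<times> D)) \<in> f ` (D \<times> D)" using DD by (intro Max_in) auto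
    then obtain x y where xy: "x \<in> D" "y \<in> D" "f (x, y) = Max (f ` (D \<times> D))" by auto
    define c where "c = commutator G x y"
    have xyC: "x \<in> C" "y \<in> C" using xy D by auto
    have cT: "c \<in> T" unfolding c_def using xyC by simp
    \<comment> \<open>If the commutator were not in \<open>W c\<close>, uniseriality would place
      \<open>W c\<close> inside the subgroup it spans with \<open>S\<close>; by the choice of
      \<open>x\<close> and \<open>y\<close> that subgroup is no larger, so the two would
      agree.\<close>
    have in_W: "commutator G u v \<in> W c" if uv: "u \<in> D" "v \<in> D" for u v
    proof -
      have dT: "commutator G u v \<in> T" using uv D(2) by (meson commutator_in_T subsetD)
      have "f (u, v) \<le> f (x, y)" unfolding xy(3) using uv DD by (intro Max_ge) auto
      then have le: "card (W (commutator G u v)) \<le> card (W c)" by (simp add: f_def c_def)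
      show ?thesis
      proof (cases "commutator G u v \<in> W c")
        case False
        then have "c \<in> W (commutator G u v)" using uni[OF dT cT] by (auto simp: W_def)
        then have "W c \<subseteq> W (commutator G u v)" by (rule W(5)[OF dT])
        then have "W c = W (commutator G u v)" using le W_fin[OF dT] by (meson card_seteq)
        then show ?thesis using W(4)[OF dT] by simp
      qed
    qed
    have cS: "c \<notin> S"
    proof
      assume "c \<in> S"
      then have "W c \<subseteq> S"
        unfolding W_def pow_coset_def
        using subgroup_int_pow_closed[OF S(1)] subgroup.m_closed[OF S(1)] by blast
      then show False using False in_W by blast
    qed
    \<comment> \<open>The part of \<open>D\<close> orthogonal to \<open>x\<close> and
      \<open>y\<close>. It misses \<open>x\<close> because \<open>c\<close> is outside
      \<open>S\<close>, so the induction hypothesis applies to it; \<open>x\<close> will join one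
      isotropic set and \<open>y\<close> the other.\<close>
    define D1 where "D1 = D \<inter> ({d \<in> C. commutator G d x \<in> S} \<inter> {d \<in> C. commutator G d y \<in> S})"
    have D1: "subgroup D1 G" unfolding D1_def
      by (intro subgroups_Inter_pair D(1) perp_subgroup_left[OF S(1)] xyC)
    have "x \<notin> D1" using cS by (simp add: D1_def c_def)
    then have "D1 \<subset> D" using xy(1) by (auto simp: D1_def)
    then have "card D1 < card D" using D(3) by (rule psubset_card_mono[rotated])
    moreover have "D1 \<subseteq> C" "finite D1" using D by (auto simp: D1_def)
    ultimately obtain A B where AB: "A \<subseteq> D1" "B \<subseteq> D1" "D1 \<subseteq> generate G (A \<union> B)"
      "A \<subseteq> perp S A" "B \<subseteq> perp S B"
      using less.hyps[OF _ D1] by blast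
    have ins: "insert z E \<subseteq> perp S (insert z E)"
      if z: "z \<in> C" "\<And>d. d \<in> D1 \<Longrightarrow> commutator G d z \<in> S" and E: "E \<subseteq> D1" "E \<subseteq> perp S E" for z E
    proof -
      have EC: "E \<subseteq> C" using E(2) by (auto simp: perp_def)
      have "commutator G z z = \<one>" using z(1) by (simp add: commutator_eq_one_iff)
      moreover have "commutator G z e \<in> S" if "e \<in> E" for e
      proof -
        have "e \<in> carrier G" "e \<in> D1" using that E(1) EC by auto
        then show ?thesis using z commutator_swap_mem[OF S(1), of e z] by simp
      qed
      ultimately show ?thesis using z E EC one by (auto simp: perp_def)
    qed
    have isoA: "insert x A \<subseteq> perp S (insert x A)" and isoB: "insert y B \<subseteq> perp S (insert y B)"
      using ins[OF xyC(1) _ AB(1,4)] ins[OF xyC(2) _ AB(2,5)] by (auto simp: D1_def)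
    define M where "M = generate G (insert x A \<union> insert y B)"
    have "insert x A \<union> insert y B \<subseteq> carrier G" using xyC AB \<open>D1 \<subseteq> C\<close> by auto
    then have M: "subgroup M G" unfolding M_def by (rule generate_is_subgroup)
    have xyM: "x \<in> M" "y \<in> M" unfolding M_def by (auto intro: generate.incl)
    have "generate G (A \<union> B) \<subseteq> M" unfolding M_def by (rule mono_generate) blast
    then have D1M: "D1 \<subseteq> M" using AB(3) by (rule subset_trans[rotated])
    have "d \<in> M" if d: "d \<in> D" for d
    proof -
      have dC: "d \<in> C" using d D(2) by blast
      obtain a s where a: "commutator G d y = c [^] (a::int) \<otimes> s" "s \<in> S"
        using in_W[OF d xy(2)] unfolding W_def pow_coset_def by blast
      obtain b r where b: "commutator G d x = c [^] (b::int) \<otimes> r" "r \<in> S"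
        using in_W[OF d xy(1)] unfolding W_def pow_coset_def by blast
      have T': "s \<in> T" "r \<in> T" using a b S(2) by auto
      have cp: "c [^] (j::int) \<in> T" for j by (rule subgroup_int_pow_closed[OF T_subgroup cT])
      have pC: "x [^] (j::int) \<in> C" "y [^] (j::int) \<in> C" for j
        using subgroup_int_pow_closed[OF C_subgroup] xyC by auto
      have cc: "c \<in> carrier G" "s \<in> carrier G" "r \<in> carrier G" using cT T' by auto
      have tw: "c [^] (j::int) \<otimes> z \<otimes> c [^] (- j) = z" if "z \<in> T" for j z
      proof -
        have "c [^] j \<otimes> z = z \<otimes> c [^] j" using C_T_commute[of "c [^] j" z] cp that by simp
        then show ?thesis using cc that cp[of j] by (simp add: int_pow_neg m_assoc)
      qed
      have lin: "commutator G (d \<otimes> x [^] (i::int) \<otimes> y [^] (j::int)) z =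
          commutator G d z \<otimes> commutator G x z [^] i \<otimes> commutator G y z [^] j" if "z \<in> C" for i j z
        unfolding commutator_mult_left[OF C_closed(1)[OF dC pC(1)] pC(2) that]
          commutator_mult_left[OF dC pC(1) that] commutator_int_pow[OF xyC(1) that]
          commutator_int_pow[OF xyC(2) that] ..
      \<comment> \<open>The component of \<open>d\<close> along the pair is removed:
        \<open>- a\<close> cancels the power of \<open>c\<close> in the commutator with
        \<open>y\<close>, and \<open>b\<close> the one with \<open>x\<close>. The signs differ
        because \<open>commutator G y x\<close> is \<open>inv c\<close>.\<close>
      define d1 where "d1 = d \<otimes> x [^] (- a) \<otimes> y [^] b"
      have d1C: "d1 \<in> C" unfolding d1_def using dC pC by simp
      have yx: "commutator G y x = inv c" unfolding c_def by (rule commutator_swap) (use xyC in auto)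
      have "commutator G d1 y = commutator G d y \<otimes> c [^] (- a) \<otimes> commutator G y y [^] b"
        unfolding d1_def lin[OF xyC(2)] c_def ..
      also have "\<dots> = s"
        unfolding a(1) tw[OF T'(1)] commutator_self[OF C_carrier[OF xyC(2)]]
        using cc(2) by (simp only: int_pow_one r_one)
      finally have 1: "commutator G d1 y \<in> S" using a(2) by simp
      have "commutator G d1 x = commutator G d x \<otimes> commutator G x x [^] (- a) \<otimes> (inv c) [^] b"
        unfolding d1_def lin[OF xyC(1)] yx ..
      also have "\<dots> = c [^] b \<otimes> r \<otimes> c [^] (- b)"
        unfolding b(1) commutator_self[OF C_carrier[OF xyC(1)]] int_pow_neg[OF cc(1)] int_pow_inv[OF cc(1)]
        using cc by (simp only: int_pow_one r_one m_closed int_pow_closed)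
      also have "\<dots> = r" by (rule tw[OF T'(2)])
      finally have 2: "commutator G d1 x \<in> S" using b(2) by simp
      have xyD: "x [^] (j::int) \<in> D" "y [^] (j::int) \<in> D" for j
        using subgroup_int_pow_closed[OF D(1)] xy by auto
      have "d1 \<in> D" unfolding d1_def
        by (intro subgroup.m_closed[OF D(1)] d xyD)
      then have "d1 \<in> M" using 1 2 d1C D1M by (auto simp: D1_def)
      moreover have "d = d1 \<otimes> y [^] (- b) \<otimes> x [^] a"
        using dC xyC by (simp add: d1_def int_pow_neg m_assoc inv_solve_right)
      moreover have "x [^] a \<in> M" "y [^] (- b) \<in> M"
        using subgroup_int_pow_closed[OF M] xyM by auto
      ultimately show ?thesis using subgroup.m_closed[OF M] by simp
    qed
    then have "D \<subseteq> generate G (insert x A \<union> insert y B)" by (auto simp: M_def)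
    moreover have "insert x A \<subseteq> D" "insert y B \<subseteq> D" using xy AB by (auto simp: D1_def)
    ultimately show ?thesis using isoA isoB by blast
  qed
qed

text \<open>A countable \<open>H \<le> C\<close> is generated by a finite set and finite subgroups \<open>D n\<close> such that
  \<open>D i\<close> and \<open>D j\<close> commute whenever \<open>\<bar>i - j\<bar> \<ge> 2\<close>. Hence the isotropic generating sets of the
  \<open>D n\<close> with \<open>n\<close> of a fixed parity unite to isotropic sets.\<close>

lemma countable_index_perp_countable:
  assumes S: "subgroup S G" "S \<subseteq> T"
    and uni: "\<And>u v. u \<in> T \<Longrightarrow> v \<in> T \<Longrightarrow> u \<in> pow_coset G S v \<or> v \<in> pow_coset G S u"
    and H: "subgroup H G" "H \<subseteq> C" "countable H"
  shows "countable_index G (perp S H)"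
proof -
  have Hc: "H \<subseteq> carrier G" using H(1) by (rule subgroup.subset)
  have Hne: "H \<noteq> {}" using subgroup.one_closed[OF H(1)] by blast
  define e where "e = from_nat_into H"
  have e: "range e = H" unfolding e_def using Hne H(3) by (rule range_from_nat_into)
  \<comment> \<open>The \<open>F n\<close> are finite subgroups exhausting \<open>H\<close>, and
    each \<open>F (Suc n)\<close> also represents all cosets in \<open>H\<close> of the centralizer
    of \<open>F n\<close>. These representatives let elements be corrected into \<open>D n\<close>
    later.\<close>
  have "\<exists>F :: nat \<Rightarrow> 'a set. \<forall>n. (finite (F n) \<and> subgroup (F n) G \<and> F n \<subseteq> H) \<and>
    (F n \<subseteq> F (Suc n) \<and> e n \<in> F (Suc n) \<and> (\<forall>x\<in>H. \<exists>f\<in>F (Suc n). x \<otimes> inv f \<in> centralizer G (F n)))"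
  proof (rule dependent_nat_choice)
    show "\<exists>F. finite F \<and> subgroup F G \<and> F \<subseteq> H"
      using triv_subgroup subgroup.one_closed[OF H(1)] by (intro exI[of _ "{\<one>}"]) simp
    fix E n assume E: "finite E \<and> subgroup E G \<and> E \<subseteq> H"
    obtain R where R: "finite R" "R \<subseteq> H" "\<And>h. h \<in> H \<Longrightarrow> \<exists>f\<in>R. h \<otimes> inv f \<in> centralizer G E"
      using finite_transversal_centralizer[of E H] E Hc by (metis subset_trans)
    define Y where "Y = insert (e n) (E \<union> R)"
    have Y: "finite Y" "Y \<subseteq> H" using E R e by (auto simp: Y_def)
    have Yg: "Y \<subseteq> generate G Y" by (auto intro: generate.incl)
    show "\<exists>F. (finite F \<and> subgroup F G \<and> F \<subseteq> H) \<and>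
      (E \<subseteq> F \<and> e n \<in> F \<and> (\<forall>x\<in>H. \<exists>f\<in>F. x \<otimes> inv f \<in> centralizer G E))"
    proof (intro exI[of _ "generate G Y"] conjI)
      show "finite (generate G Y)" "subgroup (generate G Y) G"
        using locally_finite[of Y] generate_is_subgroup[of Y] Y Hc by auto
      show "generate G Y \<subseteq> H" by (rule generate_subgroup_incl[OF Y(2) H(1)])
      show "E \<subseteq> generate G Y" "e n \<in> generate G Y" using Yg by (auto simp: Y_def)
      have "R \<subseteq> generate G Y" using Yg by (auto simp: Y_def)
      then show "\<forall>x\<in>H. \<exists>f\<in>generate G Y. x \<otimes> inv f \<in> centralizer G E" using R(3) by blast
    qed
  qed
  then obtain F :: "nat \<Rightarrow> 'a set" where F: "\<And>n. finite (F n)" "\<And>n. subgroup (F n) G" "\<And>n. F n \<subseteq> H"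
    "\<And>n. F n \<subseteq> F (Suc n)" "\<And>n. e n \<in> F (Suc n)"
    "\<And>n x. x \<in> H \<Longrightarrow> \<exists>f\<in>F (Suc n). x \<otimes> inv f \<in> centralizer G (F n)"
    by metis
  have F_mono: "F i \<subseteq> F j" if "i \<le> j" for i j using F(4) that by (rule lift_Suc_mono_le)
  define D where "D n = F (Suc (Suc n)) \<inter> centralizer G (F n)" for n
  have D: "subgroup (D n) G" "D n \<subseteq> C" "finite (D n)" for n
  proof -
    show "subgroup (D n) G" unfolding D_def
      by (intro subgroups_Inter_pair F(2) subgroup_centralizer subgroup.subset[OF F(2)])
    show "D n \<subseteq> C" "finite (D n)" using F(1,3) H(2) by (auto simp: D_def)
  qed
  \<comment> \<open>The group \<open>D i\<close> lies in \<open>F (Suc (Suc i))\<close>, hence in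
    \<open>F j\<close>, and \<open>D j\<close> centralizes \<open>F j\<close>.\<close>
  have far: "commutator G a b = \<one>" if "a \<in> D i" "b \<in> D j" "Suc (Suc i) \<le> j" for a b i j
  proof -
    have "a \<in> F j" using that F_mono by (auto simp: D_def)
    then have "b \<otimes> a = a \<otimes> b" using that(2) by (simp add: D_def centralizer_def)
    moreover have "a \<in> C" "b \<in> C" using that(1,2) D(2) by blast+
    ultimately show ?thesis by (simp add: commutator_eq_one_iff)
  qed
  have "\<forall>n. \<exists>A B. A \<subseteq> D n \<and> B \<subseteq> D n \<and> D n \<subseteq> generate G (A \<union> B) \<and> A \<subseteq> perp S A \<and> B \<subseteq> perp S B"
    using finite_two_isotropic[OF S uni D] by blast
  then obtain A B where AB: "\<And>n. A n \<subseteq> D n" "\<And>n. B n \<subseteq> D n"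
    "\<And>n. D n \<subseteq> generate G (A n \<union> B n)" "\<And>n. A n \<subseteq> perp S (A n)" "\<And>n. B n \<subseteq> perp S (B n)"
    by metis
  have union: "countable_index G (perp S (\<Union>n. P (2 * n + q)))"
    if P: "\<And>n. P n \<subseteq> D n" "\<And>n. P n \<subseteq> perp S (P n)" for P and q :: nat
  proof (rule countable_index_perp_isotropic[OF S])
    show "(\<Union>n. P (2 * n + q)) \<subseteq> C" using P(1) D(2) by blast
    show "countable (\<Union>n. P (2 * n + q))"
      using P(1) D(3) by (intro countable_UN countableI_type) (meson countable_finite finite_subset)
    have "commutator G a b \<in> S" if ab: "a \<in> P (2 * n + q)" "b \<in> P (2 * m + q)" for a b n m
    proof (cases "n = m")
      case True
      then show ?thesis using ab P(2) by (auto simp: perp_def)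
    next
      case False
      have abD: "a \<in> D (2 * n + q)" "b \<in> D (2 * m + q)" using ab P(1) by auto
      have "commutator G a b = \<one>"
      proof (cases "n < m")
        case True
        then show ?thesis using far[OF abD] by simp
      next
        case False
        then have "commutator G b a = \<one>" using far[OF abD(2,1)] \<open>n \<noteq> m\<close> by simp
        moreover have "a \<in> C" "b \<in> C" using abD D(2) by auto
        ultimately show ?thesis using commutator_swap[of b a] by simp
      qed
      then show ?thesis using S(1) by (simp add: subgroup.one_closed)
    qed
    then show "(\<Union>n. P (2 * n + q)) \<subseteq> perp S (\<Union>n. P (2 * n + q))"
      using P(1) D(2) unfolding perp_def by blast
  qed
  \<comment> \<open>One factor for the finite set \<open>F 1\<close> and four for the isotropic
    unions; the form \<open>2 * n + 0\<close> matches \<open>union\<close> at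
    \<open>q = 0\<close>.\<close>
  define V where "V = perp S (F 1) \<inter> ((perp S (\<Union>n. A (2 * n + 0)) \<inter> perp S (\<Union>n. A (2 * n + 1)))
    \<inter> (perp S (\<Union>n. B (2 * n + 0)) \<inter> perp S (\<Union>n. B (2 * n + 1))))"
  show ?thesis
  proof (rule countable_index_mono)
    have "F 1 \<subseteq> C" using F(3) H(2) by blast
    then show "countable_index G V" unfolding V_def
      by (intro countable_index_Int union AB countable_index_perp_finite[OF S(1) F(1)])
    show "V \<subseteq> perp S H"
    proof
      fix g assume g: "g \<in> V"
      then have gC: "g \<in> C" by (simp add: V_def perp_def)
      define P where "P = {x \<in> C. commutator G x g \<in> S}"
      have P: "subgroup P G" unfolding P_def by (rule perp_subgroup_left[OF S(1) gC])
      have sub: "Q k \<subseteq> P" if "g \<in> perp S (\<Union>n. Q n)" "Q k \<subseteq> C" for Q :: "nat \<Rightarrow> 'a set" and k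
        using that by (auto simp: perp_def P_def)
      have V_perp: "g \<in> perp S (\<Union>n. A (2 * n + 0))" "g \<in> perp S (\<Union>n. A (2 * n + 1))"
        "g \<in> perp S (\<Union>n. B (2 * n + 0))" "g \<in> perp S (\<Union>n. B (2 * n + 1))"
        using g by (simp_all add: V_def)
      have AC: "A n \<subseteq> C" "B n \<subseteq> C" for n using AB(1,2) D(2) by (meson subset_trans)+
      have "A n \<subseteq> P" "B n \<subseteq> P" for n
      proof -
        have "n = 2 * (n div 2) + 0 \<or> n = 2 * (n div 2) + 1" by presburger
        moreover note sub[OF V_perp(1) AC(1), of "n div 2"] sub[OF V_perp(2) AC(1), of "n div 2"]
          sub[OF V_perp(3) AC(2), of "n div 2"] sub[OF V_perp(4) AC(2), of "n div 2"]
        ultimately show "A n \<subseteq> P" "B n \<subseteq> P" by metis+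
      qed
      then have DP: "D n \<subseteq> P" for n
        using AB(3)[of n] generate_subgroup_incl[OF _ P, of "A n \<union> B n"] by blast
      have F1: "F 1 \<subseteq> P" using g F(3) H(2) by (auto simp: V_def perp_def P_def)
      \<comment> \<open>An element of \<open>F (Suc (Suc n))\<close> divided by its representative
        in \<open>F (Suc n)\<close> lies in \<open>D n\<close>. The first step already needs
        \<open>F 1\<close>, which is why it enters \<open>V\<close> separately.\<close>
      have FP: "F (Suc n) \<subseteq> P" for n
      proof (induction n)
        case 0
        then show ?case using F1 by simp
      next
        case (Suc n)
        show ?case
        proof
          fix x assume x: "x \<in> F (Suc (Suc n))"
          then obtain f where f: "f \<in> F (Suc n)" "x \<otimes> inv f \<in> centralizer G (F n)"
            using F(3,6) by blast
          have "f \<in> F (Suc (Suc n))" using f F(4) by blast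
          then have "x \<otimes> inv f \<in> D n" unfolding D_def
            using f x subgroup.m_closed[OF F(2)] subgroup.m_inv_closed[OF F(2)] by blast
          then have "x \<otimes> inv f \<otimes> f \<in> P" using DP Suc.IH f(1) subgroup.m_closed[OF P] by blast
          moreover have "x \<in> carrier G" "f \<in> carrier G" using x f F(3) Hc by blast+
          ultimately show "x \<in> P" by (simp add: m_assoc)
        qed
      qed
      have "H \<subseteq> P"
      proof
        fix h assume "h \<in> H"
        then obtain n where "h = e n" using e by blast
        then show "h \<in> P" using F(5) FP by blast
      qed
      then show "g \<in> perp S H" using gC by (auto simp: perp_def P_def)
    qed
  qed
qed

section \<open>Centralizers of countable and of finite subgroups\<close>

text \<open>Finitely many representatives reduce \<open>H\<close> to its part \<open>H0\<close> in
  \<open>C\<close>. For each nontrivial \<open>t\<close> in \<open>T\<close> a subgroup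
  \<open>S t\<close> avoiding \<open>t\<close> is chosen; an element orthogonal to \<open>H0\<close>
  modulo all of them has no commutator with \<open>H0\<close> left but the trivial one.\<close>

lemma countable_index_centralizer_countable:
  assumes H: "subgroup H G" "countable H"
  shows "countable_index G (centralizer G H)"
proof -
  have Hc: "H \<subseteq> carrier G" using H(1) by (rule subgroup.subset)
  define H0 where "H0 = H \<inter> C"
  have H0: "subgroup H0 G" "H0 \<subseteq> C" "countable H0"
    using subgroups_Inter_pair[OF H(1) C_subgroup] H(2) by (auto simp: H0_def)
  have "\<forall>t\<in>T - {\<one>}. \<exists>S. subgroup S G \<and> S \<subseteq> T \<and> t \<notin> S \<and> countable_index G (perp S H0)"
    by (metis DiffE singletonI maximal_avoiding_uniserial countable_index_perp_countable[OF _ _ _ H0])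
  then obtain S where S: "\<And>t. t \<in> T - {\<one>} \<Longrightarrow> t \<notin> S t \<and> countable_index G (perp (S t) H0)"
    by metis
  obtain R where R: "finite R" "R \<subseteq> H" "\<And>h. h \<in> H \<Longrightarrow> \<exists>f\<in>R. h \<otimes> inv f \<in> C"
    using finite_transversal_centralizer[OF finite_derived _ Hc] derived_in_carrier
    unfolding C_def by blast
  have Rc: "R \<subseteq> carrier G" using R(2) Hc by blast
  define V where "V = (C \<inter> centralizer G R) \<inter> (carrier G \<inter> (\<Inter>t\<in>T - {\<one>}. perp (S t) H0))"
  show ?thesis
  proof (rule countable_index_mono)
    show "countable_index G V" unfolding V_def
      using S T_finite
      by (intro countable_index_Int countable_index_C countable_index_centralizer[OF R(1) Rc]
          countable_index_INT) auto
    show "V \<subseteq> centralizer G H"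
    proof
      fix g assume g: "g \<in> V"
      have gC: "g \<in> C" using g by (simp add: V_def)
      have H0_comm: "g \<otimes> x = x \<otimes> g" if x: "x \<in> H0" for x
      proof -
        have xC: "x \<in> C" using x H0 by blast
        have "commutator G x g = \<one>"
        proof (rule ccontr)
          assume "commutator G x g \<noteq> \<one>"
          \<comment> \<open>The contradiction comes from the subgroup chosen for this very
            commutator, which avoids it.\<close>
          then have t: "commutator G x g \<in> T - {\<one>}" using xC gC by simp
          then have "g \<in> perp (S (commutator G x g)) H0" using g by (auto simp: V_def)
          then show False using S[OF t] x by (simp add: perp_def)
        qed
        then show ?thesis using commutator_eq_one_iff[of x g] xC gC by simp
      qed
      have "g \<otimes> h = h \<otimes> g" if h: "h \<in> H" for h
      proof -
        obtain f where f: "f \<in> R" "h \<otimes> inv f \<in> C" using R(3)[OF h] by blast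
        define x where "x = h \<otimes> inv f"
        have "x \<in> H" unfolding x_def
          using h f(1) R(2) subgroup.m_closed[OF H(1)] subgroup.m_inv_closed[OF H(1)] by blast
        then have x: "x \<in> H0" "x \<in> carrier G" using f(2) Hc by (auto simp: H0_def x_def)
        have c: "h \<in> carrier G" "f \<in> carrier G" "g \<in> carrier G" using h f R Hc gC by auto
        have hx: "h = x \<otimes> f" using c by (simp add: x_def m_assoc)
        have gf: "g \<otimes> f = f \<otimes> g" using g f(1) by (simp add: V_def centralizer_def)
        have "g \<otimes> h = g \<otimes> x \<otimes> f" unfolding hx using c x by (simp add: m_assoc)
        also have "\<dots> = x \<otimes> (g \<otimes> f)" unfolding H0_comm[OF x(1)] using c x by (simp add: m_assoc)
        also have "\<dots> = h \<otimes> g" unfolding gf hx using c x by (simp add: m_assoc)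
        finally show ?thesis .
      qed
      then show "g \<in> centralizer G H" using gC by (simp add: centralizer_def)
    qed
  qed
qed

text \<open>At the cardinal \<open>natLeq\<close> a countable index is not small enough, so finite
  \<open>H\<close> needs a finite index.\<close>

lemma finite_rcosets_centralizer:
  assumes "finite H" "H \<subseteq> carrier G"
  shows "finite (rcosets (centralizer G H))"
proof -
  obtain R where R: "finite R" "R \<subseteq> carrier G"
    "\<And>g. g \<in> carrier G \<Longrightarrow> \<exists>f\<in>R. g \<otimes> inv f \<in> centralizer G H"
    using finite_transversal_centralizer[OF assms subset_refl] by blast
  have "rcosets (centralizer G H) \<subseteq> (\<lambda>f. centralizer G H #> f) ` R"
  proof
    fix U assume "U \<in> rcosets (centralizer G H)"
    then obtain g where g: "g \<in> carrier G" "U = centralizer G H #> g" unfolding RCOSETS_def by blast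
    then obtain f where f: "f \<in> R" "g \<otimes> inv f \<in> centralizer G H" using R(3) by blast
    then have "U = centralizer G H #> f"
      unfolding g(2) using r_coset_eq_iff[OF subgroup_centralizer[OF assms(2)] g(1)] R(2) by blast
    then show "U \<in> (\<lambda>f. centralizer G H #> f) ` R" using f(1) by blast
  qed
  then show ?thesis by (rule finite_surj[OF R(1)])
qed

end

section \<open>Comparison of the two classes\<close>

text \<open>The normalizer contains the centralizer, so multiplying by it maps the cosets of the
  centralizer onto those of the normalizer, and the index can only drop.\<close>

lemma class_Z_imp_class_Y:
  fixes G :: "('a, 'b) monoid_scheme"
  assumes "class_Z G"
  shows "class_Y G"
  unfolding class_Y_def
proof (intro conjI allI impI)
  show lf: "locally_finite_group G" using assms by (simp add: class_Z_def)
  fix \<kappa> :: "'a set rel" and H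
  assume \<kappa>: "Cinfinite \<kappa>" and H: "subgroup H G" "|H| <o \<kappa>"
  interpret group G using lf by (simp add: locally_finite_group_def)
  have Hc: "H \<subseteq> carrier G" using H(1) by (rule subgroup.subset)
  let ?C = "centralizer G H" and ?N = "normalizer G H"
  have N: "subgroup ?N G" by (rule normalizer_imp_subgroup[OF Hc])
  have C: "subgroup ?C G" by (rule subgroup_centralizer[OF Hc])
  have CN: "?C \<subseteq> ?N" by (rule centralizer_subset_normalizer[OF H(1)])
  have "?N #>\<^bsub>G\<^esub> g = ?N <#>\<^bsub>G\<^esub> (?C #>\<^bsub>G\<^esub> g)" if "g \<in> carrier G" for g
  proof -
    have "?N <#>\<^bsub>G\<^esub> ?C = ?N"
    proof
      show "?N <#>\<^bsub>G\<^esub> ?C \<subseteq> ?N"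
        using subgroup.m_closed[OF N] CN unfolding set_mult_def by blast
      show "?N \<subseteq> ?N <#>\<^bsub>G\<^esub> ?C"
      proof
        fix n assume n: "n \<in> ?N"
        then have "n = n \<otimes>\<^bsub>G\<^esub> \<one>\<^bsub>G\<^esub>" using subgroup.mem_carrier[OF N] by simp
        then show "n \<in> ?N <#>\<^bsub>G\<^esub> ?C"
          using n subgroup.one_closed[OF C] unfolding set_mult_def by blast
      qed
    qed
    then show ?thesis
      using setmult_rcos_assoc[OF subgroup.subset[OF N] subgroup.subset[OF C] that] by simp
  qed
  then have "rcosets\<^bsub>G\<^esub> ?N = (\<lambda>U. ?N <#>\<^bsub>G\<^esub> U) ` (rcosets\<^bsub>G\<^esub> ?C)"
    unfolding RCOSETS_def by auto
  then have "|rcosets\<^bsub>G\<^esub> ?N| \<le>o |rcosets\<^bsub>G\<^esub> ?C|" by (metis card_of_image)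
  then show "|rcosets\<^bsub>G\<^esub> ?N| <o \<kappa>"
    using assms \<kappa> H unfolding class_Z_def by (blast intro: ordLeq_ordLess_trans)
qed

lemma countable_iff_ordLess_cardSuc: "countable A \<longleftrightarrow> |A| <o cardSuc natLeq"
  by (simp add: countable_card_le_natLeq cardSuc_ordLeq_ordLess natLeq_Card_order)

text \<open>The size of \<open>H\<close> decides. For finite \<open>H\<close> the index is finite,
  for countably infinite \<open>H\<close> it is at most \<open>|H|\<close>, and an uncountable
  \<open>H\<close> has at least the cardinality of \<open>G\<close>, which bounds every
  index.\<close>

lemma class_Y_imp_class_Z:
  fixes G :: "('a, 'b) monoid_scheme"
  assumes fba: "finite_by_abelian G" and card: "|carrier G| =o cardSuc natLeq" and Y: "class_Y G"
  shows "class_Z G"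
  unfolding class_Z_def
proof (intro conjI allI impI)
  show lf: "locally_finite_group G" using Y by (simp add: class_Y_def)
  interpret group G using lf by (simp add: locally_finite_group_def)
  interpret finite_derived_Y G
  proof
    show "finite (derived G (carrier G))" using fba by (simp add: finite_by_abelian_def)
    show "finite (generate G R)" if "R \<subseteq> carrier G" "finite R" for R
      using lf that by (simp add: locally_finite_group_def)
    show "countable_index G (normalizer G K)" if K: "subgroup K G" "countable K" for K
    proof -
      \<comment> \<open>The cardinal \<open>cardSuc natLeq\<close> is a relation on sets of naturals
        rather than on sets of group elements, hence the appeal to
        \<open>class_Y_all_cardinals\<close>.\<close>
      have "|rcosets\<^bsub>G\<^esub> (normalizer G K)| <o cardSuc natLeq"
        using class_Y_all_cardinals[OF Y Cinfinite_cardSuc[OF natLeq_Cinfinite] K(1)] K(2)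
        by (simp add: countable_iff_ordLess_cardSuc)
      then show ?thesis
        using countable_index_iff[OF normalizer_imp_subgroup[OF subgroup.subset[OF K(1)]]]
        by (simp add: countable_iff_ordLess_cardSuc)
    qed
  qed
  fix \<kappa> :: "'a set rel" and H
  assume \<kappa>: "Cinfinite \<kappa>" and H: "subgroup H G" "|H| <o \<kappa>"
  have Hc: "H \<subseteq> carrier G" using H(1) by (rule subgroup.subset)
  let ?I = "rcosets\<^bsub>G\<^esub> (centralizer G H)"
  consider "finite H" | "infinite H" "countable H" | "uncountable H" by blast
  then show "|?I| <o \<kappa>"
  proof cases
    case 1
    then have "finite ?I" by (rule finite_rcosets_centralizer[OF _ Hc])
    then show ?thesis
      using \<kappa> by (intro finite_ordLess_infinite)
        (auto simp: cinfinite_def card_of_Well_order Field_card_of card_order_on_well_order_on)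
  next
    case 2
    have "countable ?I"
      using countable_index_centralizer_countable[OF H(1) 2(2)]
        countable_index_iff[OF subgroup_centralizer[OF Hc]] by simp
    then have "|?I| \<le>o natLeq" by (simp add: countable_card_le_natLeq)
    also have "natLeq \<le>o |H|" using 2(1) infinite_iff_natLeq_ordLeq by blast
    finally show ?thesis using H(2) by (rule ordLeq_ordLess_trans)
  next
    case 3
    then have "natLeq <o |H|"
      by (simp add: countable_card_le_natLeq not_ordLeq_iff_ordLess natLeq_Well_order card_of_Well_order)
    then have "cardSuc natLeq \<le>o |H|"
      using cardSuc_ordLess_ordLeq[OF natLeq_Card_order card_of_Card_order] by blast
    moreover have "|?I| \<le>o |carrier G|"
    proof -
      have "?I = (\<lambda>g. centralizer G H #>\<^bsub>G\<^esub> g) ` carrier G" unfolding RCOSETS_def by auto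
      then show ?thesis by (metis card_of_image)
    qed
    ultimately have "|?I| \<le>o |H|"
      using card by (meson ordLeq_ordIso_trans ordLeq_transitive)
    then show ?thesis using H(2) by (rule ordLeq_ordLess_trans)
  qed
qed

theorem theoremC:
  fixes G :: "('a, 'b) monoid_scheme"
  assumes "finite_by_abelian G"
    and "|carrier G| =o cardSuc natLeq"
  shows "class_Y G \<longleftrightarrow> class_Z G"
  using class_Y_imp_class_Z[OF assms] class_Z_imp_class_Y by blast

end
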